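(* The marked shift spectrum of a complete length space with a universal cover determines its covering spectrum. That is: if $X$ and $Y$ are complete length spaces with universal covers which have the same marked shift spectrum, then $CovSpec(X)=CovSpec(Y)$.
   Context: A complete length space is a complete metric space in which every pair of points is joined by a length-minimizing rectifiable curve whose length is the distance between the points. A universal cover $\tilde X$ of $X$ is a covering space of $X$ that covers every other covering space of $X$ (it is not assumed simply connected); covering spaces carry the lifted length metric. Each $g\in\pi_1(X)$ is viewed as a deck transformation of $\tilde X$, and its length is $L(g)=\inf_{\tilde x\in\tilde X}d_{\tilde X}(g\tilde x,\tilde x)\in[0,\infty)$. The marked shift spectrum of $X$ is the map $\pi_1(X)\to[0,\infty)$, $g\mapsto L(g)$. Two spaces $X,Y$ have the same marked shift spectrum if there is a group isomorphism $f:\pi_1(X)\to\pi_1(Y)$ with $L(f(g))=L(g)$ for all $g\in\pi_1(X)$. For $\delta>0$, $\pi_1(X,\delta)$ is the subgroup of $\pi_1(X)$ generated by all $g$ with $L(g)<2\delta$, and the $\delta$ cover is $\tilde X^\delta=\tilde X/\pi_1(X,\delta)$. The covering spectrum $CovSpec(X)$ is the set of all $\delta>0$ such that $\tilde X^\delta\neq\tilde X^{\delta'}$ for all $\delta'>\delta$; equivalently, $\pi_1(X,\delta)\neq\pi_1(X,\delta')$ for all $\delta'>\delta$. *)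

theory Defs
  imports "HOL-Analysis.Analysis" "HOL-Algebra.Generated_Groups"
begin

section \<open>Complete length spaces\<close>

definition path_length :: "'a metric \<Rightarrow> (real \<Rightarrow> 'a) \<Rightarrow> ennreal" where
  "path_length M \<gamma> =
     (SUP ts \<in> {ts. sorted ts \<and> set ts \<subseteq> {0..1}}.
        \<Sum>i<length ts - 1. ennreal (mdist M (\<gamma> (ts ! i)) (\<gamma> (ts ! Suc i))))"

definition complete_length_space :: "'a metric \<Rightarrow> bool" where
  "complete_length_space M \<longleftrightarrow>
     mcomplete_of M \<and>
     (\<forall>x \<in> mspace M. \<forall>y \<in> mspace M.
        \<exists>\<gamma>. pathin (mtopology_of M) \<gamma> \<and> \<gamma> 0 = x \<and> \<gamma> 1 = y \<and>
            path_length M \<gamma> = ennreal (mdist M x y))"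


section \<open>Covering spaces\<close>

text \<open>
  The library's \<open>covering_space\<close> speaks about subsets of topological types. Quotients of a cover
  and the covers quantified over in the universal property have no such ambient type,
  so the same notion is stated here for abstract topologies.
\<close>

definition covering_map :: "'b topology \<Rightarrow> 'a topology \<Rightarrow> ('b \<Rightarrow> 'a) \<Rightarrow> bool" where
  "covering_map E X p \<longleftrightarrow>
     continuous_map E X p \<and> p ` topspace E = topspace X \<and>
     (\<forall>x \<in> topspace X. \<exists>U. openin X U \<and> x \<in> U \<and>
        (\<exists>\<V>. \<Union>\<V> = {e \<in> topspace E. p e \<in> U} \<and>
             (\<forall>V \<in> \<V>. openin E V) \<and>
             pairwise disjnt \<V> \<and>
             (\<forall>V \<in> \<V>. homeomorphic_map (subtopology E V) (subtopology X U) p)))"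

definition connected_cover :: "'a topology \<Rightarrow> 'b topology \<Rightarrow> ('b \<Rightarrow> 'a) \<Rightarrow> bool" where
  "connected_cover X E p \<longleftrightarrow> connected_space E \<and> covering_map E X p"

definition covers :: "'b topology \<Rightarrow> ('b \<Rightarrow> 'a) \<Rightarrow> 'c topology \<Rightarrow> ('c \<Rightarrow> 'a) \<Rightarrow> bool" where
  "covers E p C r \<longleftrightarrow>
     (\<exists>f. covering_map E C f \<and> (\<forall>x \<in> topspace E. r (f x) = p x))"

definition isomorphic_covers ::
    "'b topology \<Rightarrow> ('b \<Rightarrow> 'a) \<Rightarrow> 'c topology \<Rightarrow> ('c \<Rightarrow> 'a) \<Rightarrow> bool" where
  "isomorphic_covers E p C r \<longleftrightarrow>
     (\<exists>f. homeomorphic_map E C f \<and> (\<forall>x \<in> topspace E. r (f x) = p x))"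

text \<open>
  HOL cannot quantify over all types inside a formula, so the competing covers \<open>C\<close> live on the type
  of sets of paths in the base. For the spaces considered here this is no restriction: in a connected
  cover of a path connected, locally path connected space with a chosen base point \<open>c\<^sub>0\<close>, sending \<open>c\<close>
  to the nonempty set of those paths in the base whose lift starting at \<open>c\<^sub>0\<close> ends at \<open>c\<close> is injective,
  and transporting the topology along it gives an isomorphic cover on this type.
  Simple connectedness is not required.
\<close>

definition universal_cover :: "'a topology \<Rightarrow> 'b topology \<Rightarrow> ('b \<Rightarrow> 'a) \<Rightarrow> bool" where
  "universal_cover X E p \<longleftrightarrow>
     connected_cover X E p \<and>
     (\<forall>(C :: (real \<Rightarrow> 'a) set topology) r. connected_cover X C r \<longrightarrow> covers E p C r)"

text \<open>
  A deck transformation is only relevant on \<open>topspace E\<close>; extensionality makes it unique as a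
  HOL function.
\<close>

definition deck_transformations :: "'b topology \<Rightarrow> ('b \<Rightarrow> 'a) \<Rightarrow> ('b \<Rightarrow> 'b) set" where
  "deck_transformations E p =
     {\<phi> \<in> extensional (topspace E).
        homeomorphic_map E E \<phi> \<and> (\<forall>x \<in> topspace E. p (\<phi> x) = p x)}"

definition quotient_topology :: "'b topology \<Rightarrow> ('b \<Rightarrow> 'c) \<Rightarrow> 'c topology" where
  "quotient_topology E q =
     topology (\<lambda>U. U \<subseteq> q ` topspace E \<and> openin E {x \<in> topspace E. q x \<in> U})"

lemma openin_quotient_topology:
  "openin (quotient_topology E q) U \<longleftrightarrow>
     U \<subseteq> q ` topspace E \<and> openin E {x \<in> topspace E. q x \<in> U}"
proof -
  have "istopology (\<lambda>U. U \<subseteq> q ` topspace E \<and> openin E {x \<in> topspace E. q x \<in> U})"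
    unfolding istopology_def
  proof (intro conjI allI impI)
    fix S T
    assume S: "S \<subseteq> q ` topspace E \<and> openin E {x \<in> topspace E. q x \<in> S}"
      and T: "T \<subseteq> q ` topspace E \<and> openin E {x \<in> topspace E. q x \<in> T}"
    then show "S \<inter> T \<subseteq> q ` topspace E" by blast
    have "{x \<in> topspace E. q x \<in> S \<inter> T} =
          {x \<in> topspace E. q x \<in> S} \<inter> {x \<in> topspace E. q x \<in> T}" by blast
    with S T show "openin E {x \<in> topspace E. q x \<in> S \<inter> T}" by (simp add: openin_Int)
  next
    fix \<K>
    assume K: "\<forall>K\<in>\<K>. K \<subseteq> q ` topspace E \<and> openin E {x \<in> topspace E. q x \<in> K}"
    then show "\<Union>\<K> \<subseteq> q ` topspace E" by blast
    have "{x \<in> topspace E. q x \<in> \<Union>\<K>} = (\<Union>K\<in>\<K>. {x \<in> topspace E. q x \<in> K})" by blast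
    with K show "openin E {x \<in> topspace E. q x \<in> \<Union>\<K>}" by (metis (no_types, lifting) openin_Union image_iff)
  qed
  then show ?thesis by (simp add: quotient_topology_def topology_inverse')
qed

lemma topspace_quotient_topology: "topspace (quotient_topology E q) = q ` topspace E"
proof
  show "topspace (quotient_topology E q) \<subseteq> q ` topspace E"
    using openin_quotient_topology openin_topspace by metis
  have "{x \<in> topspace E. q x \<in> q ` topspace E} = topspace E" by blast
  then have "openin (quotient_topology E q) (q ` topspace E)"
    by (simp add: openin_quotient_topology)
  then show "q ` topspace E \<subseteq> topspace (quotient_topology E q)" by (rule openin_subset)
qed

lemma quotient_map_quotient_topology: "quotient_map E (quotient_topology E q) q"
  by (auto simp: quotient_map_def topspace_quotient_topology openin_quotient_topology)


section \<open>The fundamental group\<close>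

definition loops_at :: "'a topology \<Rightarrow> 'a \<Rightarrow> (real \<Rightarrow> 'a) set" where
  "loops_at X x = {\<gamma>. pathin X \<gamma> \<and> \<gamma> 0 = x \<and> \<gamma> 1 = x}"

definition loop_class :: "'a topology \<Rightarrow> 'a \<Rightarrow> (real \<Rightarrow> 'a) \<Rightarrow> (real \<Rightarrow> 'a) set" where
  "loop_class X x \<gamma> =
     {\<eta>. homotopic_with (\<lambda>h. h 0 = x \<and> h 1 = x) (top_of_set {0..1}) X \<gamma> \<eta>}"

text \<open>The library's \<open>+++\<close> requires the target to be of class \<open>topological_space\<close>.\<close>

definition concat_paths :: "(real \<Rightarrow> 'a) \<Rightarrow> (real \<Rightarrow> 'a) \<Rightarrow> real \<Rightarrow> 'a" where
  "concat_paths \<gamma> \<eta> = (\<lambda>t. if t \<le> 1 / 2 then \<gamma> (2 * t) else \<eta> (2 * t - 1))"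

definition fundamental_group :: "'a topology \<Rightarrow> 'a \<Rightarrow> (real \<Rightarrow> 'a) set monoid" where
  "fundamental_group X x =
     \<lparr>carrier = loop_class X x ` loops_at X x,
      monoid.mult = (\<lambda>g h. \<Union>\<gamma>\<in>g. \<Union>\<eta>\<in>h. loop_class X x (concat_paths \<gamma> \<eta>)),
      one = loop_class X x (\<lambda>t. x)\<rparr>"

text \<open>
  The deck transformation attached to \<open>g \<in> \<pi>\<^sub>1(X, p(e))\<close>: the one moving the base point \<open>e\<close> to
  the end point of the lift, starting at \<open>e\<close>, of a loop representing \<open>g\<close>. For a universal cover of a
  complete length space it exists and is unique, since universal covers are regular. The map
  from \<open>\<pi>\<^sub>1\<close> to deck transformations has a kernel when the cover is not simply connected.
\<close>

definition deck_of ::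
    "'b topology \<Rightarrow> ('b \<Rightarrow> 'a) \<Rightarrow> 'b \<Rightarrow> (real \<Rightarrow> 'a) set \<Rightarrow> 'b \<Rightarrow> 'b" where
  "deck_of E p e g =
     (THE \<phi>. \<phi> \<in> deck_transformations E p \<and>
        (\<exists>\<gamma>. pathin E \<gamma> \<and> \<gamma> 0 = e \<and> \<gamma> 1 = \<phi> e \<and> p \<circ> \<gamma> \<in> g))"


section \<open>Marked shift spectrum and covering spectrum\<close>

text \<open>
  Lengths take values in \<open>ennreal\<close>, so that no convention for empty infima is involved; for
  connected covers of complete length spaces the values are finite.
\<close>

definition lifted_dist :: "'a metric \<Rightarrow> 'b topology \<Rightarrow> ('b \<Rightarrow> 'a) \<Rightarrow> 'b \<Rightarrow> 'b \<Rightarrow> ennreal" where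
  "lifted_dist M E p x y =
     (INF \<gamma> \<in> {\<gamma>. pathin E \<gamma> \<and> \<gamma> 0 = x \<and> \<gamma> 1 = y}. path_length M (p \<circ> \<gamma>))"

definition shift_length ::
    "'a metric \<Rightarrow> 'b topology \<Rightarrow> ('b \<Rightarrow> 'a) \<Rightarrow> 'b \<Rightarrow> (real \<Rightarrow> 'a) set \<Rightarrow> ennreal" where
  "shift_length M E p e g = (INF x \<in> topspace E. lifted_dist M E p (deck_of E p e g x) x)"

abbreviation based_pi1 :: "'a metric \<Rightarrow> ('b \<Rightarrow> 'a) \<Rightarrow> 'b \<Rightarrow> (real \<Rightarrow> 'a) set monoid" where
  "based_pi1 M p e \<equiv> fundamental_group (mtopology_of M) (p e)"

definition same_marked_shift_spectrum ::
    "'a metric \<Rightarrow> 'b topology \<Rightarrow> ('b \<Rightarrow> 'a) \<Rightarrow> 'b \<Rightarrow>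
     'c metric \<Rightarrow> 'd topology \<Rightarrow> ('d \<Rightarrow> 'c) \<Rightarrow> 'd \<Rightarrow> bool" where
  "same_marked_shift_spectrum M E p e N F q f \<longleftrightarrow>
     (\<exists>\<Phi> \<in> iso (based_pi1 M p e) (based_pi1 N q f).
        \<forall>g \<in> carrier (based_pi1 M p e). shift_length N F q f (\<Phi> g) = shift_length M E p e g)"

definition delta_subgroup ::
    "'a metric \<Rightarrow> 'b topology \<Rightarrow> ('b \<Rightarrow> 'a) \<Rightarrow> 'b \<Rightarrow> real \<Rightarrow> (real \<Rightarrow> 'a) set set" where
  "delta_subgroup M E p e \<delta> =
     generate (based_pi1 M p e)
       {g \<in> carrier (based_pi1 M p e). shift_length M E p e g < ennreal (2 * \<delta>)}"

definition delta_orbit ::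
    "'a metric \<Rightarrow> 'b topology \<Rightarrow> ('b \<Rightarrow> 'a) \<Rightarrow> 'b \<Rightarrow> real \<Rightarrow> 'b \<Rightarrow> 'b set" where
  "delta_orbit M E p e \<delta> x = (\<lambda>g. deck_of E p e g x) ` delta_subgroup M E p e \<delta>"

definition delta_cover ::
    "'a metric \<Rightarrow> 'b topology \<Rightarrow> ('b \<Rightarrow> 'a) \<Rightarrow> 'b \<Rightarrow> real \<Rightarrow> 'b set topology" where
  "delta_cover M E p e \<delta> = quotient_topology E (delta_orbit M E p e \<delta>)"

text \<open>The covering projection of a quotient of \<open>E\<close>; \<open>p\<close> is constant on each orbit.\<close>

definition orbit_proj :: "('b \<Rightarrow> 'a) \<Rightarrow> 'b set \<Rightarrow> 'a" where
  "orbit_proj p A = the_elem (p ` A)"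

text \<open>
  Two \<open>\<delta>\<close> covers count as equal when they are isomorphic as covering spaces of \<open>X\<close>.
\<close>

definition CovSpec :: "'a metric \<Rightarrow> 'b topology \<Rightarrow> ('b \<Rightarrow> 'a) \<Rightarrow> 'b \<Rightarrow> real set" where
  "CovSpec M E p e =
     {\<delta>. \<delta> > 0 \<and>
        (\<forall>\<delta>' > \<delta>. \<not> isomorphic_covers (delta_cover M E p e \<delta>) (orbit_proj p)
                                    (delta_cover M E p e \<delta>') (orbit_proj p))}"

end

theory Submission
  imports Defs
begin

text \<open>
  The two covering spectra are compared through the subgroups generated by short elements. The key
  fact, \<open>isomorphic_delta_covers_iff\<close>, says that two \<open>\<delta>\<close> covers are isomorphic exactly when the
  subgroups defining them coincide. Hence \<open>CovSpec\<close> is a property of the family of subgroups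
  \<open>\<delta> \<mapsto> delta_subgroup \<delta>\<close> alone, and an isomorphism of fundamental groups that preserves the shift
  lengths carries one family onto the other.

  For the key fact let \<open>H \<subseteq> K\<close> be two of these subgroups and \<open>F\<close> an isomorphism from \<open>E/H\<close> to \<open>E/K\<close>
  over \<open>X\<close>. Since \<open>E\<close> is regular, \<open>F\<close> sends the orbit of the base point \<open>e\<close> to the orbit of
  \<open>\<phi> e\<close> for some deck transformation \<open>\<phi>\<close>. Then \<open>x \<mapsto> F [x]\<^sub>H\<close> and \<open>x \<mapsto> [\<phi> x]\<^sub>K\<close> are two lifts of
  the projection \<open>E \<rightarrow> X\<close> to \<open>E/K\<close> which agree at \<open>e\<close>, hence everywhere. As \<open>K\<close> is normal (shift
  length is invariant under conjugation), the second one is constant on the \<open>K\<close> orbit of \<open>e\<close>, and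
  injectivity of \<open>F\<close> puts this orbit into the \<open>H\<close> orbit of \<open>e\<close>. So every \<open>k \<in> K\<close> acts like some
  \<open>h \<in> H\<close>; the two differ by an element acting trivially, which has shift length \<open>0\<close> and therefore
  lies in \<open>H\<close>. See \<open>isomorphic_orbit_spaces_imp_subset\<close>.

  This needs the fundamental group to act on \<open>E\<close> through deck transformations, transitively on
  fibres (\<open>deck_of_path\<close>, \<open>deck_of_mult\<close>, \<open>deck_of_transitive\<close>). That the action is well defined
  rests on path and homotopy lifting. That it exists rests on regularity of universal covers
  (\<open>universal_cover_regular\<close>), which is not immediate because \<open>E\<close> need not be simply connected and
  the universal property carries no base points. The reason is that \<open>X\<close> has a connected cover \<open>C\<close>
  dominating all pointed versions of \<open>E\<close> at once: its points are maps from the fibre over a base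
  point onto another fibre, obtained by continuing the identity. A map \<open>E \<rightarrow> C\<close> over \<open>X\<close>, followed by
  evaluation at a suitable point of the fibre, moves \<open>e\<close> to any prescribed point of its fibre.
\<close>

section \<open>Evenly covered sets and uniqueness of lifts\<close>

text \<open>
  The common ground of covers and orbit spaces on which uniqueness of lifts rests. Two points of the
  same fibre of a cover are separated by the sheets containing them.
\<close>

definition lift_separated :: "'b topology \<Rightarrow> ('b \<Rightarrow> 'a) \<Rightarrow> bool" where
  "lift_separated E p \<longleftrightarrow>
     (\<forall>x \<in> topspace E. \<exists>V. openin E V \<and> x \<in> V \<and> inj_on p V) \<and>
     (\<forall>x \<in> topspace E. \<forall>y \<in> topspace E. p x = p y \<and> x \<noteq> y \<longrightarrow>
        (\<exists>V W. openin E V \<and> openin E W \<and> x \<in> V \<and> y \<in> W \<and> disjnt V W))"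

text \<open>
  The set where two lifts agree is open by local injectivity of the projection and closed because
  distinct points of a fibre have disjoint neighbourhoods.
\<close>

lemma lifts_agree:
  assumes E: "lift_separated E p" and Z: "connected_space Z"
    and k: "continuous_map Z E k" and l: "continuous_map Z E l"
    and eq: "\<And>z. z \<in> topspace Z \<Longrightarrow> p (k z) = p (l z)"
    and z0: "z0 \<in> topspace Z" "k z0 = l z0" and z: "z \<in> topspace Z"
  shows "k z = l z"
proof -
  have kE: "k z \<in> topspace E" and lE: "l z \<in> topspace E" if "z \<in> topspace Z" for z
    using that k l by (auto simp: continuous_map_def)
  let ?A = "{z \<in> topspace Z. k z = l z}"
  have 1: "openin Z ?A"
  proof (subst openin_subopen, intro ballI)
    fix z assume z: "z \<in> ?A"
    then obtain V where V: "openin E V" "k z \<in> V" "inj_on p V"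
      using E kE unfolding lift_separated_def by blast
    let ?T = "{w \<in> topspace Z. k w \<in> V} \<inter> {w \<in> topspace Z. l w \<in> V}"
    have "openin Z ?T"
      using k l V(1) by (intro openin_Int openin_continuous_map_preimage)
    moreover have "?T \<subseteq> ?A" using V(3) eq by (auto simp: inj_on_def)
    moreover have "z \<in> ?T" using z V by auto
    ultimately show "\<exists>T. openin Z T \<and> z \<in> T \<and> T \<subseteq> ?A" by blast
  qed
  have 2: "openin Z (topspace Z - ?A)"
  proof (subst openin_subopen, intro ballI)
    fix z assume z: "z \<in> topspace Z - ?A"
    then obtain V W where V: "openin E V" "openin E W" "k z \<in> V" "l z \<in> W" "disjnt V W"
      using E kE[of z] lE[of z] eq[of z] unfolding lift_separated_def by blast
    let ?T = "{w \<in> topspace Z. k w \<in> V} \<inter> {w \<in> topspace Z. l w \<in> W}"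
    have "openin Z ?T"
      using k l V(1,2) by (intro openin_Int openin_continuous_map_preimage)
    moreover have "?T \<subseteq> topspace Z - ?A" using V(5) by (auto simp: disjnt_iff)
    moreover have "z \<in> ?T" using z V by auto
    ultimately show "\<exists>T. openin Z T \<and> z \<in> T \<and> T \<subseteq> topspace Z - ?A" by blast
  qed
  have "closedin Z ?A" using 2 by (auto simp: closedin_def)
  with 1 Z z0 have "?A = topspace Z" unfolding connected_space_clopen_in by blast
  with z show ?thesis by blast
qed

definition evenly_covered ::
    "'b topology \<Rightarrow> 'a topology \<Rightarrow> ('b \<Rightarrow> 'a) \<Rightarrow> 'a set \<Rightarrow> 'b set set \<Rightarrow> bool" where
  "evenly_covered E X p U \<V> \<longleftrightarrow>
     openin X U \<and> \<Union>\<V> = {e \<in> topspace E. p e \<in> U} \<and> (\<forall>V \<in> \<V>. openin E V) \<and>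
     pairwise disjnt \<V> \<and> (\<forall>V \<in> \<V>. homeomorphic_map (subtopology E V) (subtopology X U) p)"

lemma evenly_coveredI:
  assumes "openin X U" "\<Union>\<V> = {e \<in> topspace E. p e \<in> U}" "\<And>V. V \<in> \<V> \<Longrightarrow> openin E V"
    "pairwise disjnt \<V>"
    "\<And>V. V \<in> \<V> \<Longrightarrow> homeomorphic_map (subtopology E V) (subtopology X U) p"
  shows "evenly_covered E X p U \<V>"
  using assms by (simp add: evenly_covered_def)

lemma covering_map_evenly_covered:
  "covering_map E X p \<longleftrightarrow> continuous_map E X p \<and> p ` topspace E = topspace X \<and>
     (\<forall>x \<in> topspace X. \<exists>U \<V>. x \<in> U \<and> evenly_covered E X p U \<V>)"
  unfolding covering_map_def evenly_covered_def by meson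

lemma evenly_covered_obtain_sheet:
  assumes "evenly_covered E X p U \<V>" "b \<in> topspace E" "p b \<in> U"
  obtains V where "V \<in> \<V>" "b \<in> V"
proof -
  have "b \<in> \<Union>\<V>" using assms by (simp add: evenly_covered_def)
  then show thesis using that by blast
qed

lemma evenly_covered_sheetD:
  assumes "evenly_covered E X p U \<V>" "V \<in> \<V>"
  shows "openin E V" "V \<subseteq> topspace E" "p ` V = U" "inj_on p V"
    "homeomorphic_map (subtopology E V) (subtopology X U) p"
proof -
  show h: "homeomorphic_map (subtopology E V) (subtopology X U) p" and o: "openin E V"
    using assms by (auto simp: evenly_covered_def)
  show s: "V \<subseteq> topspace E" using o openin_subset by blast
  have "U \<subseteq> topspace X" using assms by (auto simp: evenly_covered_def openin_subset)
  then show "p ` V = U" "inj_on p V"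
    using homeomorphic_imp_surjective_map[OF h] homeomorphic_imp_injective_map[OF h] s
    by (auto simp: Int_absorb1)
qed

lemma evenly_covered_subset:
  assumes "evenly_covered E X p U \<V>" and "openin X U'" "U' \<subseteq> U" and p: "continuous_map E X p"
  shows "evenly_covered E X p U' ((\<lambda>V. {e \<in> V. p e \<in> U'}) ` \<V>)"
proof -
  note ec = evenly_covered_sheetD[OF assms(1)]
  have "homeomorphic_map (subtopology E {e \<in> V. p e \<in> U'}) (subtopology X U') p" if V: "V \<in> \<V>" for V
  proof -
    have "p ` (topspace (subtopology E V) \<inter> {e \<in> V. p e \<in> U'})
            = topspace (subtopology X U) \<inter> U'"
      using ec(2,3)[OF V] assms(2,3) openin_subset by fastforce
    from homeomorphic_map_subtopologies[OF ec(5)[OF V] this]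
    have "homeomorphic_map (subtopology (subtopology E V) {e \<in> V. p e \<in> U'}) (subtopology (subtopology X U) U') p" 
      by simp
    moreover have "V \<inter> {e \<in> V. p e \<in> U'} = {e \<in> V. p e \<in> U'}" "U \<inter> U' = U'" using assms(3) by auto
    ultimately show ?thesis by (simp add: subtopology_subtopology)
  qed
  moreover have "openin E {e \<in> V. p e \<in> U'}" if V: "V \<in> \<V>" for V
    using openin_continuous_map_preimage_gen[OF p ec(1)[OF V] assms(2)] .
  moreover have "\<Union>\<V> = {e \<in> topspace E. p e \<in> U}" "pairwise disjnt \<V>"
    using assms(1) by (auto simp: evenly_covered_def)
  moreover have "\<Union>((\<lambda>V. {e \<in> V. p e \<in> U'}) ` \<V>) = {e \<in> \<Union>\<V>. p e \<in> U'}" by auto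
  moreover have "pairwise disjnt ((\<lambda>V. {e \<in> V. p e \<in> U'}) ` \<V>)"
    using \<open>pairwise disjnt \<V>\<close> by (fastforce simp: pairwise_def disjnt_iff)
  ultimately show ?thesis using assms(2,3)
    unfolding evenly_covered_def by auto
qed

text \<open>
  Each sheet is clopen in the preimage of the evenly covered set: its complement there is the union
  of the other sheets.
\<close>

lemma connectedin_subset_sheet:
  assumes ec: "evenly_covered E X p U \<V>" and V: "V \<in> \<V>" "b \<in> V"
    and S: "connectedin E S" "p ` S \<subseteq> U" "b \<in> S"
  shows "S \<subseteq> V"
proof -
  have U: "\<Union>\<V> = {e \<in> topspace E. p e \<in> U}" "pairwise disjnt \<V>" "\<forall>V \<in> \<V>. openin E V"
    using ec by (auto simp: evenly_covered_def)
  have "S \<subseteq> V \<union> \<Union>(\<V> - {V})" using U(1) S connectedin_subset_topspace[OF S(1)] by blast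
  moreover have "V \<inter> \<Union>(\<V> - {V}) \<inter> S = {}" using U(2) V(1) by (auto simp: pairwise_def disjnt_iff)
  moreover have "openin E V" "openin E (\<Union>(\<V> - {V}))" using U(3) V by auto
  moreover have "V \<inter> S \<noteq> {}" using V S by auto
  ultimately have "\<Union>(\<V> - {V}) \<inter> S = {}" using S(1) unfolding connectedin by blast
  then show ?thesis using \<open>S \<subseteq> V \<union> \<Union>(\<V> - {V})\<close> by blast
qed

text \<open>
  Sheets are described intrinsically, as components, so that no decomposition has to be chosen. For
  path connected evenly covered sets this gives the members of any decomposition (\<open>sheet_eq\<close>).
\<close>

definition sheet :: "'b topology \<Rightarrow> ('b \<Rightarrow> 'a) \<Rightarrow> 'a set \<Rightarrow> 'b \<Rightarrow> 'b set" where
  "sheet E p U b = connected_component_of_set (subtopology E {e \<in> topspace E. p e \<in> U}) b"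

lemma sheet_eq:
  assumes ec: "evenly_covered E X p U \<V>" and U: "path_connectedin X U" and V: "V \<in> \<V>" "b \<in> V"
  shows "sheet E p U b = V"
proof
  let ?P = "{e \<in> topspace E. p e \<in> U}"
  note e = evenly_covered_sheetD[OF ec V(1)]
  have S: "connectedin E (sheet E p U b)" "sheet E p U b \<subseteq> ?P"
    using connectedin_connected_component_of[of "subtopology E ?P" b]
    by (auto simp: sheet_def connectedin_subtopology)
  have b: "b \<in> topspace (subtopology E ?P)" using V(2) e by auto
  then have "b \<in> sheet E p U b" by (simp add: sheet_def connected_component_of_refl)
  with S show "sheet E p U b \<subseteq> V" by (intro connectedin_subset_sheet[OF ec V S(1)]) auto
  have "connectedin (subtopology E V) V"
    using homeomorphic_map_connectedness_eq[OF e(5), of V] e(2,3) U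
      path_connectedin_imp_connectedin[OF U] by (auto simp: connectedin_subtopology)
  then have "connectedin (subtopology E ?P) V"
    using e(2,3) by (auto simp: connectedin_subtopology)
  from connected_component_of_maximal[OF this V(2)] show "V \<subseteq> sheet E p U b"
    by (simp add: sheet_def)
qed

definition elementary :: "'b topology \<Rightarrow> 'a topology \<Rightarrow> ('b \<Rightarrow> 'a) \<Rightarrow> 'a set \<Rightarrow> bool" where
  "elementary E X p U \<longleftrightarrow> path_connectedin X U \<and> (\<exists>\<V>. evenly_covered E X p U \<V>)"

lemma elementary_openin: "elementary E X p U \<Longrightarrow> openin X U"
  by (auto simp: elementary_def evenly_covered_def)

lemma elementary_base:
  assumes "covering_map E X p" "locally_path_connected_space X" "openin X W" "x \<in> W"
  obtains U where "elementary E X p U" "x \<in> U" "U \<subseteq> W"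
proof -
  have x: "x \<in> topspace X" using assms openin_subset by blast
  obtain U0 \<V> where 1: "x \<in> U0" "evenly_covered E X p U0 \<V>"
    using assms(1) x unfolding covering_map_evenly_covered by meson
  then have "openin X (U0 \<inter> W)" using assms by (auto simp: evenly_covered_def)
  then obtain U where U: "openin X U" "path_connectedin X U" "x \<in> U" "U \<subseteq> U0 \<inter> W"
    using assms(2,4) 1(1) unfolding locally_path_connected_space by (metis IntI)
  then show thesis
    using that evenly_covered_subset[OF 1(2), of U] assms(1)
    unfolding elementary_def covering_map_def by auto
qed

lemma sheet_elementary:
  assumes U: "elementary E X p U" and b: "b \<in> topspace E" "p b \<in> U"
  shows "b \<in> sheet E p U b" "openin E (sheet E p U b)" "sheet E p U b \<subseteq> topspace E"
    "p ` sheet E p U b = U" "inj_on p (sheet E p U b)"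
    "homeomorphic_map (subtopology E (sheet E p U b)) (subtopology X U) p"
    "\<And>c. c \<in> sheet E p U b \<Longrightarrow> sheet E p U c = sheet E p U b"
    "connectedin E (sheet E p U b)"
proof -
  obtain \<V> where ec: "evenly_covered E X p U \<V>" and pc: "path_connectedin X U"
    using U by (auto simp: elementary_def)
  obtain V where V: "V \<in> \<V>" "b \<in> V" using evenly_covered_obtain_sheet[OF ec b] .
  note s = sheet_eq[OF ec pc V]
  show "b \<in> sheet E p U b" "openin E (sheet E p U b)" "sheet E p U b \<subseteq> topspace E"
    "p ` sheet E p U b = U" "inj_on p (sheet E p U b)"
    "homeomorphic_map (subtopology E (sheet E p U b)) (subtopology X U) p"
    using evenly_covered_sheetD[OF ec V(1)] V(2) by (simp_all add: s)
  show "sheet E p U c = sheet E p U b" if "c \<in> sheet E p U b" for c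
    using that sheet_eq[OF ec pc V(1)] by (simp add: s)
  show "connectedin E (sheet E p U b)"
    using connectedin_connected_component_of[of "subtopology E {e \<in> topspace E. p e \<in> U}" b]
    by (auto simp: sheet_def connectedin_subtopology)
qed

lemma sheet_subset:
  assumes U: "elementary E X p U" and U': "elementary E X p U'" "U' \<subseteq> U"
    and b: "b \<in> topspace E" "p b \<in> U'" and p: "continuous_map E X p"
  shows "sheet E p U' b = {e \<in> sheet E p U b. p e \<in> U'}"
proof -
  obtain \<V> where ec: "evenly_covered E X p U \<V>" and pc: "path_connectedin X U"
    using U by (auto simp: elementary_def)
  obtain V where V: "V \<in> \<V>" "b \<in> V" using evenly_covered_obtain_sheet[OF ec b(1)] b U'(2) by blast
  have "evenly_covered E X p U' ((\<lambda>V. {e \<in> V. p e \<in> U'}) ` \<V>)"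
    using evenly_covered_subset[OF ec elementary_openin[OF U'(1)] U'(2) p] .
  moreover have "path_connectedin X U'" using U' by (simp add: elementary_def)
  ultimately have "sheet E p U' b = {e \<in> V. p e \<in> U'}"
    using V b by (intro sheet_eq) auto
  then show ?thesis using sheet_eq[OF ec pc V] by simp
qed

lemma connectedin_subset_component_sheet:
  assumes "elementary E X p U" "connectedin E S" "p ` S \<subseteq> U" "b \<in> S"
  shows "S \<subseteq> sheet E p U b"
proof -
  have "connectedin (subtopology E {e \<in> topspace E. p e \<in> U}) S"
    using assms connectedin_subset_topspace by (fastforce simp: connectedin_subtopology)
  from connected_component_of_maximal[OF this assms(4)] show ?thesis by (simp add: sheet_def)
qed

lemma covering_map_lift_separated:
  assumes "covering_map E X p"
  shows "lift_separated E p"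
  unfolding lift_separated_def
proof (intro conjI ballI impI)
  have *: "\<exists>U \<V>. p x \<in> U \<and> evenly_covered E X p U \<V>" if "x \<in> topspace E" for x
    using assms that unfolding covering_map_evenly_covered by (metis imageI)
  show "\<exists>V. openin E V \<and> x \<in> V \<and> inj_on p V" if x: "x \<in> topspace E" for x
  proof -
    obtain U \<V> where U: "p x \<in> U" "evenly_covered E X p U \<V>" using *[OF x] by blast
    obtain V where "V \<in> \<V>" "x \<in> V" using evenly_covered_obtain_sheet[OF U(2) x U(1)] .
    then show ?thesis using evenly_covered_sheetD(1,4)[OF U(2)] by metis
  qed
  fix x y assume x: "x \<in> topspace E" and y: "y \<in> topspace E" and xy: "p x = p y \<and> x \<noteq> y"
  obtain U \<V> where U: "p x \<in> U" "evenly_covered E X p U \<V>" using *[OF x] by blast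
  obtain V where V1: "V \<in> \<V>" "x \<in> V" using evenly_covered_obtain_sheet[OF U(2) x U(1)] .
  have "p y \<in> U" using U(1) xy by simp
  then obtain W where "W \<in> \<V>" "y \<in> W" using evenly_covered_obtain_sheet[OF U(2) y] by blast
  note V = V1 this
  have "V \<noteq> W" using evenly_covered_sheetD(4)[OF U(2) V(1)] V xy by (auto simp: inj_on_def)
  then have "disjnt V W" using U(2) V by (auto simp: evenly_covered_def pairwise_def)
  then show "\<exists>V W. openin E V \<and> openin E W \<and> x \<in> V \<and> y \<in> W \<and> disjnt V W"
    using V evenly_covered_sheetD(1)[OF U(2)] by metis
qed

section \<open>Lifting paths and homotopies\<close>

text \<open>
  Every starting value over any point is to extend. This uniform form allows neighbouring pieces to
  be glued: a lift on one piece prescribes the value at a common point for the other.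
\<close>

definition lifts_on ::
    "'b topology \<Rightarrow> ('b \<Rightarrow> 'a) \<Rightarrow> ('z::topological_space \<Rightarrow> 'a) \<Rightarrow> 'z set \<Rightarrow> bool" where
  "lifts_on E p h R \<longleftrightarrow>
     (\<forall>z \<in> R. \<forall>e \<in> topspace E. p e = h z \<longrightarrow>
        (\<exists>k. continuous_map (top_of_set R) E k \<and> (\<forall>w \<in> R. p (k w) = h w) \<and> k z = e))"

lemma lifts_on_evenly_covered:
  assumes ec: "evenly_covered E X p U \<V>" and h: "continuous_map (top_of_set R) X h" and R: "h ` R \<subseteq> U"
  shows "lifts_on E p h R"
  unfolding lifts_on_def
proof (intro ballI impI)
  fix z e assume z: "z \<in> R" and e: "e \<in> topspace E" "p e = h z"
  have "p e \<in> U" using z e R by auto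
  then obtain V where V: "V \<in> \<V>" "e \<in> V" using evenly_covered_obtain_sheet[OF ec e(1)] by blast
  note i = evenly_covered_sheetD[OF ec V(1)]
  obtain g where g: "homeomorphic_maps (subtopology E V) (subtopology X U) p g"
    using i(5) homeomorphic_map_maps by blast
  have UX: "U \<subseteq> topspace X" using ec by (auto simp: evenly_covered_def openin_subset)
  have gc: "continuous_map (subtopology X U) (subtopology E V) g"
    and gp: "\<And>v. v \<in> V \<Longrightarrow> g (p v) = v" and pg: "\<And>u. u \<in> U \<Longrightarrow> p (g u) = u"
    using g i(2) UX unfolding homeomorphic_maps_def by (simp_all add: Int_absorb1 subset_iff)
  have "continuous_map (top_of_set R) (subtopology X U) h"
    using h R by (auto simp: continuous_map_in_subtopology)
  from continuous_map_compose[OF this gc] have "continuous_map (top_of_set R) E (g \<circ> h)"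
    by (simp add: continuous_map_in_subtopology)
  moreover have "\<forall>w \<in> R. p ((g \<circ> h) w) = h w" using pg R by auto
  moreover have "(g \<circ> h) z = e" using gp[OF V(2)] e by simp
  ultimately show "\<exists>k. continuous_map (top_of_set R) E k \<and> (\<forall>w \<in> R. p (k w) = h w) \<and> k z = e"
    by blast
qed

lemma continuous_map_lift_agree:
  assumes "lift_separated E p" "connected R"
    and "continuous_map (top_of_set R) E k" "continuous_map (top_of_set R) E l"
    and "\<And>z. z \<in> R \<Longrightarrow> p (k z) = p (l z)" and "z0 \<in> R" "k z0 = l z0" "z \<in> R"
  shows "k z = l z"
  using assms by (intro lifts_agree[of E p "top_of_set R" k l z0 z])
    (auto simp: connected_space_subtopology)

text \<open>
  Connectedness of the overlap makes the two partial lifts agree on all of it once they agree at one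
  point.
\<close>

lemma lifts_on_Un:
  assumes E: "lift_separated E p" and cl: "closed R" "closed S" and c: "connected (R \<inter> S)" "R \<inter> S \<noteq> {}"
    and R: "lifts_on E p h R" and S: "lifts_on E p h S"
  shows "lifts_on E p h (R \<union> S)"
proof -
  have main: "\<exists>k. continuous_map (top_of_set (A \<union> B)) E k \<and> (\<forall>w \<in> A \<union> B. p (k w) = h w) \<and> k z = e"
    if cl: "closed A" "closed B" and c: "connected (A \<inter> B)" "A \<inter> B \<noteq> {}"
      and A: "lifts_on E p h A" and B: "lifts_on E p h B"
      and z: "z \<in> A" and e: "e \<in> topspace E" "p e = h z" for A B z e
  proof -
    obtain k where k: "continuous_map (top_of_set A) E k" "\<And>w. w \<in> A \<Longrightarrow> p (k w) = h w" "k z = e"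
      using A z e unfolding lifts_on_def by metis
    obtain w where w: "w \<in> A" "w \<in> B" using c by auto
    have "k w \<in> topspace E" using k(1) w(1) by (auto simp: continuous_map_def)
    then obtain l where l: "continuous_map (top_of_set B) E l" "\<And>w. w \<in> B \<Longrightarrow> p (l w) = h w" "l w = k w"
      using B w k(2)[OF w(1)] unfolding lifts_on_def by metis
    have kl: "continuous_map (top_of_set (A \<inter> B)) E k" "continuous_map (top_of_set (A \<inter> B)) E l"
      using k(1) l(1) continuous_map_from_subtopology_mono[of euclidean] by blast+
    have "p (k x) = p (l x)" if "x \<in> A \<inter> B" for x using that k(2) l(2) by simp
    then have agree: "k x = l x" if "x \<in> A" "x \<in> B" for x
      using continuous_map_lift_agree[OF E c(1) kl, of w x] w that l(3) by simp
    let ?m = "\<lambda>x. if x \<in> A then k x else l x"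
    have "continuous_map (top_of_set (A \<union> B)) E ?m"
    proof (rule pasting_lemma_closed[where I = "{True, False}" and T = "\<lambda>b. if b then A else B"
            and f = "\<lambda>b. if b then k else l"])
      show "closedin (top_of_set (A \<union> B)) (if b then A else B)" for b
        using cl by (auto simp: closedin_closed_eq closed_subset)
      have "subtopology (top_of_set (A \<union> B)) A = top_of_set A"
        "subtopology (top_of_set (A \<union> B)) B = top_of_set B"
        by (auto simp: subtopology_subtopology Int_absorb1)
      then show "continuous_map (subtopology (top_of_set (A \<union> B)) (if b then A else B)) E (if b then k else l)" for b
        using k l by simp
    qed (use agree in \<open>auto split: if_splits\<close>)
    moreover have "\<forall>w \<in> A \<union> B. p (?m w) = h w" using k l by auto
    moreover have "?m z = e" using z k by simp
    ultimately show ?thesis by blast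
  qed
  show ?thesis unfolding lifts_on_def
  proof (intro ballI impI)
    fix z e assume "z \<in> R \<union> S" and e: "e \<in> topspace E" "p e = h z"
    then consider "z \<in> R" | "z \<in> S" by blast
    then show "\<exists>k. continuous_map (top_of_set (R \<union> S)) E k \<and> (\<forall>w\<in>R \<union> S. p (k w) = h w) \<and> k z = e"
    proof cases
      case 1 then show ?thesis using main[OF cl c R S _ e] by blast
    next
      case 2 then show ?thesis using main[OF cl(2,1) _ _ S R _ e] c by (simp add: Int_commute Un_commute)
    qed
  qed
qed

text \<open>
  Small rectangles map into evenly covered sets. Bisecting in the second coordinate glues them to thin
  strips \<open>[a, b] \<times> [0, 1]\<close>, and bisecting in the first glues the strips to the square.
\<close>

lemma homotopy_lifting:
  fixes h :: "real \<times> real \<Rightarrow> 'a"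
  assumes E: "covering_map E X p" and h: "continuous_map (top_of_set ({0..1} \<times> {0..1})) X h"
  shows "lifts_on E p h ({0..1} \<times> {0..1})"
proof -
  note sep = covering_map_lift_separated[OF E]
  have cell: "\<exists>r>0. \<forall>a b c d. a \<le> x \<and> x \<le> b \<and> b - a < r \<and> 0 \<le> a \<and> b \<le> 1 \<and>
                c \<le> y \<and> y \<le> d \<and> d - c < r \<and> 0 \<le> c \<and> d \<le> 1 \<longrightarrow> lifts_on E p h ({a..b} \<times> {c..d})"
    if xy: "0 \<le> x" "x \<le> 1" "0 \<le> y" "y \<le> 1" for x y
  proof -
    have "h (x, y) \<in> topspace X" using h xy by (auto simp: continuous_map_def)
    then obtain U \<V> where U: "h (x, y) \<in> U" "evenly_covered E X p U \<V>"
      using E unfolding covering_map_evenly_covered by meson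
    have "openin (top_of_set ({0..1} \<times> {0..1})) {w \<in> {0..1} \<times> {0..1}. h w \<in> U}"
      using openin_continuous_map_preimage[OF h, of U] U(2) by (simp add: evenly_covered_def)
    then obtain T where T: "open T" "{w \<in> {0..1} \<times> {0..1}. h w \<in> U} = ({0..1} \<times> {0..1}) \<inter> T"
      by (auto simp: openin_open)
    have "(x, y) \<in> {w \<in> {0..1} \<times> {0..1}. h w \<in> U}" using xy U by simp
    then have "(x, y) \<in> T" unfolding T(2) by simp
    then obtain A B where AB: "open A" "open B" "x \<in> A" "y \<in> B" "A \<times> B \<subseteq> T"
      using T(1) by (auto elim: open_prod_elim)
    obtain r where r: "r > 0" "ball x r \<subseteq> A" using AB open_contains_ball by blast
    obtain s where s: "s > 0" "ball y s \<subseteq> B" using AB open_contains_ball by blast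
    show ?thesis
    proof (intro exI[of _ "min r s"] conjI allI impI)
      fix a b c d assume *: "a \<le> x \<and> x \<le> b \<and> b - a < min r s \<and> 0 \<le> a \<and> b \<le> 1 \<and>
                c \<le> y \<and> y \<le> d \<and> d - c < min r s \<and> 0 \<le> c \<and> d \<le> 1"
      have "{a..b} \<subseteq> A" using r(2) * by (force simp: dist_real_def subset_iff)
      moreover have "{c..d} \<subseteq> B" using s(2) * by (force simp: dist_real_def subset_iff)
      ultimately have "{a..b} \<times> {c..d} \<subseteq> ({0..1} \<times> {0..1}) \<inter> T" using AB(5) * by auto
      then have sub: "{a..b} \<times> {c..d} \<subseteq> {w \<in> {0..1} \<times> {0..1}. h w \<in> U}" using T(2) by simp
      show "lifts_on E p h ({a..b} \<times> {c..d})"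
      proof (rule lifts_on_evenly_covered[OF U(2)])
        show "continuous_map (top_of_set ({a..b} \<times> {c..d})) X h"
          using continuous_map_from_subtopology_mono[OF h, of "{a..b} \<times> {c..d}"] sub by auto
      qed (use sub in auto)
    qed (use r s in auto)
  qed
  have strip: "\<exists>r>0. \<forall>a b. a \<le> x \<and> x \<le> b \<and> b - a < r \<and> 0 \<le> a \<and> b \<le> 1
          \<longrightarrow> lifts_on E p h ({a..b} \<times> {0..1})" if x: "0 \<le> x" "x \<le> 1" for x
  proof -
    \<comment> \<open>The width \<open>r\<close> of the strip is quantified inside, so that it may shrink when two rectangles are glued.\<close>
    let ?Q = "\<lambda>c d. 0 \<le> c \<and> d \<le> 1 \<longrightarrow> (\<exists>r>0. \<forall>a b. a \<le> x \<and> x \<le> b \<and> b - a < r \<and> 0 \<le> a \<and> b \<le> 1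
          \<longrightarrow> lifts_on E p h ({a..b} \<times> {c..d}))"
    have "?Q 0 1"
    proof (cases rule: Bolzano[where P = ?Q and a = 0 and b = 1, consumes 0, case_names le trans local])
      case (trans c m d)
      show ?case
      proof
        assume cd: "0 \<le> c \<and> d \<le> 1"
        obtain r where r: "r > 0" "\<And>a b. a \<le> x \<and> x \<le> b \<and> b - a < r \<and> 0 \<le> a \<and> b \<le> 1
          \<Longrightarrow> lifts_on E p h ({a..b} \<times> {c..m})" using trans cd by auto
        obtain s where s: "s > 0" "\<And>a b. a \<le> x \<and> x \<le> b \<and> b - a < s \<and> 0 \<le> a \<and> b \<le> 1
          \<Longrightarrow> lifts_on E p h ({a..b} \<times> {m..d})" using trans cd by auto
        show "\<exists>r>0. \<forall>a b. a \<le> x \<and> x \<le> b \<and> b - a < r \<and> 0 \<le> a \<and> b \<le> 1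
          \<longrightarrow> lifts_on E p h ({a..b} \<times> {c..d})"
        proof (intro exI[of _ "min r s"] conjI allI impI)
          fix a b assume *: "a \<le> x \<and> x \<le> b \<and> b - a < min r s \<and> 0 \<le> a \<and> b \<le> 1"
          have i: "({a..b} \<times> {c..m}) \<inter> ({a..b} \<times> {m..d}) = {a..b} \<times> {m}"
            and u: "({a..b} \<times> {c..m}) \<union> ({a..b} \<times> {m..d}) = {a..b} \<times> {c..d}"
            using trans by auto
          have "lifts_on E p h (({a..b} \<times> {c..m}) \<union> ({a..b} \<times> {m..d}))"
          proof (rule lifts_on_Un[OF sep])
            show "connected (({a..b} \<times> {c..m}) \<inter> ({a..b} \<times> {m..d}))"
              unfolding i by (intro connected_Times) auto
            show "({a..b} \<times> {c..m}) \<inter> ({a..b} \<times> {m..d}) \<noteq> {}" unfolding i using * by auto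
            show "lifts_on E p h ({a..b} \<times> {c..m})" using * by (intro r) auto
            show "lifts_on E p h ({a..b} \<times> {m..d})" using * by (intro s) auto
          qed (auto intro: closed_Times)
          then show "lifts_on E p h ({a..b} \<times> {c..d})" unfolding u .
        qed (use r s in auto)
      qed
    next
      case (local y)
      obtain r where r: "r>0" "\<forall>a b c d. a \<le> x \<and> x \<le> b \<and> b - a < r \<and> 0 \<le> a \<and> b \<le> 1 \<and>
                c \<le> y \<and> y \<le> d \<and> d - c < r \<and> 0 \<le> c \<and> d \<le> 1 \<longrightarrow> lifts_on E p h ({a..b} \<times> {c..d})"
        using cell[OF x local] by blast
      show ?case
      proof (rule exI[of _ r], intro conjI allI impI)
        fix c d :: real assume "c \<le> y \<and> y \<le> d \<and> d - c < r" "0 \<le> c \<and> d \<le> 1"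
        with r show "\<exists>r>0. \<forall>a b. a \<le> x \<and> x \<le> b \<and> b - a < r \<and> 0 \<le> a \<and> b \<le> 1
          \<longrightarrow> lifts_on E p h ({a..b} \<times> {c..d})" by (intro exI[of _ r]) blast
      qed (use r in auto)
    qed auto
    then show ?thesis by simp
  qed
  let ?P = "\<lambda>a b. 0 \<le> a \<and> b \<le> 1 \<longrightarrow> lifts_on E p h ({a..b} \<times> {0..1})"
  have "?P 0 1"
  proof (cases rule: Bolzano[where P = ?P and a = 0 and b = 1, consumes 0, case_names le trans local])
    case (trans a m b)
    show ?case
    proof
      assume ab: "0 \<le> a \<and> b \<le> 1"
      have i: "({a..m} \<times> {0..1}) \<inter> ({m..b} \<times> {0..1::real}) = {m} \<times> {0..1}"
        and u: "({a..m} \<times> {0..1}) \<union> ({m..b} \<times> {0..1::real}) = {a..b} \<times> {0..1}"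
        using trans by auto
      have "lifts_on E p h (({a..m} \<times> {0..1}) \<union> ({m..b} \<times> {0..1}))"
      proof (rule lifts_on_Un[OF sep])
        show "connected (({a..m} \<times> {0..1}) \<inter> ({m..b} \<times> {0..1::real}))"
          unfolding i by (intro connected_Times) auto
        show "({a..m} \<times> {0..1}) \<inter> ({m..b} \<times> {0..1::real}) \<noteq> {}" unfolding i by auto
      qed (use trans ab in \<open>auto intro: closed_Times\<close>)
      then show "lifts_on E p h ({a..b} \<times> {0..1})" unfolding u .
    qed
  next
    case (local x)
    then show ?case using strip[OF local] by meson
  qed auto
  then show ?thesis by simp
qed

text \<open>
  A path is a homotopy that does not depend on its first parameter.
\<close>

lemma path_lifting:
  assumes E: "covering_map E X p" and \<gamma>: "pathin X \<gamma>" and e: "e \<in> topspace E" "p e = \<gamma> 0"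
  obtains \<gamma>' where "pathin E \<gamma>'" "\<gamma>' 0 = e" "\<And>t. t \<in> {0..1} \<Longrightarrow> p (\<gamma>' t) = \<gamma> t"
proof -
  have "continuous_map (top_of_set ({0..1} \<times> {0..1})) (top_of_set {0..1}) (snd :: real \<times> real \<Rightarrow> real)"
    by (auto simp: continuous_map_in_subtopology intro: continuous_intros)
  from continuous_map_compose[OF this \<gamma>[unfolded pathin_def]]
  have "lifts_on E p (\<gamma> \<circ> snd) ({0..1::real} \<times> {0..1})" by (rule homotopy_lifting[OF E])
  then have "\<exists>k. continuous_map (top_of_set ({0..1::real} \<times> {0..1})) E k \<and>
      (\<forall>w \<in> {0..1::real} \<times> {0..1}. p (k w) = (\<gamma> \<circ> snd) w) \<and> k (0, 0) = e"
    unfolding lifts_on_def using e by auto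
  then obtain k where k: "continuous_map (top_of_set ({0..1::real} \<times> {0..1})) E k"
      "\<And>w. w \<in> {0..1::real} \<times> {0..1} \<Longrightarrow> p (k w) = (\<gamma> \<circ> snd) w" "k (0, 0) = e"
    by blast
  have "continuous_map (top_of_set {0..1}) (top_of_set ({0..1} \<times> {0..1})) (\<lambda>t::real. (0::real, t))"
    by (auto simp: continuous_map_in_subtopology intro: continuous_intros)
  from continuous_map_compose[OF this k(1)] have "pathin E (k \<circ> (\<lambda>t. (0, t)))" by (simp add: pathin_def)
  then show thesis using that[of "k \<circ> (\<lambda>t. (0, t))"] k(2,3) by simp
qed

text \<open>
  In a lift of the homotopy the two vertical sides are the given lifts, while both horizontal sides
  lie over a constant path and are therefore constant.
\<close>

lemma lift_endpoints_homotopic: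
  fixes E :: "'b topology" and X :: "'a topology"
  assumes E: "covering_map E X p"
    and hom: "homotopic_with (\<lambda>h. h 0 = x \<and> h 1 = y) (top_of_set {0..1}) X \<gamma> \<eta>"
    and \<gamma>': "pathin E \<gamma>'" "\<And>t. t \<in> {0..1} \<Longrightarrow> p (\<gamma>' t) = \<gamma> t"
    and \<eta>': "pathin E \<eta>'" "\<And>t. t \<in> {0..1} \<Longrightarrow> p (\<eta>' t) = \<eta> t"
    and eq: "\<gamma>' 0 = \<eta>' 0"
  shows "\<gamma>' 1 = \<eta>' 1"
proof -
  note sep = covering_map_lift_separated[OF E]
  obtain h :: "real \<times> real \<Rightarrow> 'a" where h: "continuous_map (prod_topology (top_of_set {0..1}) (top_of_set {0..1})) X h"
    and h0: "\<forall>t. h (0, t) = \<gamma> t" and h1: "\<forall>t. h (1, t) = \<eta> t"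
    and hxy: "\<forall>s\<in>{0..1}. h (s, 0) = x \<and> h (s, 1) = y"
    using hom unfolding homotopic_with_def by blast
  have hx: "h (s, 0) = x" and hy: "h (s, 1) = y" if "s \<in> {0..1}" for s using hxy that by auto
  have e: "\<gamma>' 0 \<in> topspace E" using path_start_in_topspace \<gamma>' by blast
  have "lifts_on E p h ({0..1::real} \<times> {0..1})"
    using h by (intro homotopy_lifting[OF E]) (simp add: prod_topology_subtopology_eu)
  then have "\<exists>k. continuous_map (top_of_set ({0..1::real} \<times> {0..1})) E k \<and>
      (\<forall>w \<in> {0..1::real} \<times> {0..1}. p (k w) = h w) \<and> k (0, 0) = \<gamma>' 0"
    unfolding lifts_on_def using e \<gamma>'(2)[of 0] h0 by simp
  then obtain k where k: "continuous_map (top_of_set ({0..1::real} \<times> {0..1})) E k"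
      "\<And>w. w \<in> {0..1::real} \<times> {0..1} \<Longrightarrow> p (k w) = h w" "k (0, 0) = \<gamma>' 0"
    by blast
  have "continuous_map (top_of_set {0..1}) (top_of_set ({0..1} \<times> {0..1})) (\<lambda>t::real. (s, t))"
    "continuous_map (top_of_set {0..1}) (top_of_set ({0..1} \<times> {0..1})) (\<lambda>t::real. (t, s))"
    if "s \<in> {0..1::real}" for s
    using that by (auto simp: continuous_map_in_subtopology intro: continuous_intros)
  from this[THEN continuous_map_compose, OF _ k(1)]
  have kp: "continuous_map (top_of_set {0..1}) E (\<lambda>t. k (s, t))"
    "continuous_map (top_of_set {0..1}) E (\<lambda>t. k (t, s))" if "s \<in> {0..1}" for s
    using that by (auto simp: o_def)
  have kE: "k (0, 1) \<in> topspace E" using k(1) by (auto simp: continuous_map_def)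
  have agree: "k t = l t"
    if "continuous_map (top_of_set {0..1}) E k" "continuous_map (top_of_set {0..1}) E l"
      "\<And>t. t \<in> {0..1} \<Longrightarrow> p (k t) = p (l t)" "k 0 = l 0" "t \<in> {0..1}"
    for k l :: "real \<Rightarrow> 'b" and t
    using continuous_map_lift_agree[OF sep connected_Icc that(1-3) _ that(4,5)] by simp
  have 1: "k (0, 1) = \<gamma>' 1"
    by (rule agree[where k = "\<lambda>t. k (0, t)"]) (use kp \<gamma>' k h0 in \<open>auto simp: pathin_def\<close>)
  have "p (\<gamma>' 0) = x" using \<gamma>'(2)[of 0] h0 hx[of 0] by simp
  note px = this
  have 2: "k (1, 0) = k (0, 0)"
    by (rule agree[where k = "\<lambda>t. k (t, 0)" and l = "\<lambda>t. k (0, 0)"]) (use kp k hx e px in auto)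
  have 3: "k (1, 1) = k (0, 1)"
    by (rule agree[where k = "\<lambda>t. k (t, 1)" and l = "\<lambda>t. k (0, 1)"]) (use kp k hy kE in auto)
  have 4: "k (1, 1) = \<eta>' 1"
    by (rule agree[where k = "\<lambda>t. k (1, t)"]) (use kp \<eta>' k h1 2 eq in \<open>auto simp: pathin_def\<close>)
  show ?thesis using 1 3 4 by simp
qed

section \<open>Components of covers and the universal property\<close>

text \<open>
  Sheets over small sets form a base, as the projection restricts to a homeomorphism on a sheet.
\<close>

lemma sheet_base:
  assumes E: "covering_map E X p" and X: "locally_path_connected_space X" and W: "openin E W" "b \<in> W"
  obtains U where "elementary E X p U" "p b \<in> U" "sheet E p U b \<subseteq> W"
proof -
  have p: "continuous_map E X p" using E by (simp add: covering_map_def)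
  have b: "b \<in> topspace E" using W openin_subset by blast
  then have "p b \<in> topspace X" using p by (auto simp: continuous_map_def)
  then obtain U where U: "elementary E X p U" "p b \<in> U"
    using elementary_base[OF E X openin_topspace] by metis
  note s = sheet_elementary[OF U(1) b U(2)]
  have "openin (subtopology E (sheet E p U b)) (W \<inter> sheet E p U b)"
    using W by (auto simp: openin_subtopology)
  then have "openin (subtopology X U) (p ` (W \<inter> sheet E p U b))"
    using homeomorphic_imp_open_map[OF s(6)] by (simp add: open_map_def)
  then have "openin X (p ` (W \<inter> sheet E p U b))"
    using openin_open_subtopology[OF elementary_openin[OF U(1)]] by blast
  moreover have "p b \<in> p ` (W \<inter> sheet E p U b)" using W s(1) by blast
  ultimately obtain U' where U': "elementary E X p U'" "p b \<in> U'" "U' \<subseteq> p ` (W \<inter> sheet E p U b)"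
    using elementary_base[OF E X] by metis
  have "U' \<subseteq> U" using U'(3) s(4) by blast
  have "sheet E p U' b \<subseteq> W"
  proof
    fix c assume "c \<in> sheet E p U' b"
    then have c: "c \<in> sheet E p U b" "p c \<in> U'"
      using sheet_subset[OF U(1) U'(1) \<open>U' \<subseteq> U\<close> b U'(2) p] by auto
    then obtain d where "d \<in> W" "d \<in> sheet E p U b" "p d = p c" using U'(3) by auto
    then show "c \<in> W" using inj_onD[OF s(5)] c(1) by metis
  qed
  then show thesis using that U' by blast
qed

lemma covering_map_locally_path_connected:
  assumes E: "covering_map E X p" and X: "locally_path_connected_space X"
  shows "locally_path_connected_space E"
  unfolding locally_path_connected_space
proof (intro allI impI)
  fix W b assume W: "openin E W \<and> b \<in> W"
  obtain U where U: "elementary E X p U" "p b \<in> U" "sheet E p U b \<subseteq> W"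
    using sheet_base[OF E X] W by metis
  have b: "b \<in> topspace E" using W openin_subset by blast
  note s = sheet_elementary[OF U(1) b U(2)]
  have "path_connectedin (subtopology E (sheet E p U b)) (sheet E p U b)"
    using homeomorphic_map_path_connectedness_eq[OF s(6), of "sheet E p U b"] s(3,4) U(1)
    by (simp add: elementary_def path_connectedin_subtopology)
  then show "\<exists>U. openin E U \<and> path_connectedin E U \<and> b \<in> U \<and> U \<subseteq> W"
    using s(1,2) U(3) by (auto simp: path_connectedin_subtopology)
qed

text \<open>
  Sheets over path connected sets are connected, so each lies inside the component or misses it. Hence
  the image of the component is clopen, and over each evenly covered set the component is a union of
  sheets.
\<close>

lemma covering_map_component:
  assumes p: "continuous_map E X p" and X: "connected_space X" and b: "b \<in> topspace E"
    and ec: "\<And>x. x \<in> topspace X \<Longrightarrow>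
               \<exists>U \<V>. x \<in> U \<and> path_connectedin X U \<and> evenly_covered E X p U \<V>"
  shows "covering_map (subtopology E (connected_component_of_set E b)) X p"
proof -
  let ?C = "connected_component_of_set E b"
  have CE: "?C \<subseteq> topspace E" by (simp add: connected_component_of_subset_topspace)
  have bC: "b \<in> ?C" using b by (simp add: connected_component_of_refl)
  have sheet_in: "V \<subseteq> ?C"
    if U: "path_connectedin X U" "evenly_covered E X p U \<V>" and V: "V \<in> \<V>" "c \<in> V" "c \<in> ?C" for U \<V> V c
  proof -
    have c: "c \<in> topspace E" "p c \<in> U" using V(2) evenly_covered_sheetD(2,3)[OF U(2) V(1)] by auto
    have "elementary E X p U" using U by (auto simp: elementary_def)
    from sheet_elementary(8)[OF this c] have "connectedin E V" using sheet_eq[OF U(2,1) V(1,2)] by simp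
    then have "V \<subseteq> connected_component_of_set E c" using V(2) by (rule connected_component_of_maximal)
    also have "\<dots> = ?C" using V(3) by (metis connected_component_of_equiv mem_Collect_eq)
    finally show ?thesis .
  qed
  have reach: "U \<subseteq> p ` ?C" if U: "path_connectedin X U" "evenly_covered E X p U \<V>" and ne: "U \<inter> p ` ?C \<noteq> {}" for U \<V>
  proof -
    obtain c where c: "c \<in> ?C" "p c \<in> U" using ne by auto
    have "c \<in> topspace E" using CE c(1) by blast
    then obtain V where V: "V \<in> \<V>" "c \<in> V" using evenly_covered_obtain_sheet[OF U(2) _ c(2)] by metis
    show ?thesis using sheet_in[OF U V c(1)] evenly_covered_sheetD(3)[OF U(2) V(1)] by blast
  qed
  have pC: "p ` ?C \<subseteq> topspace X" using CE p by (auto simp: continuous_map_def)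
  have dich: "\<exists>U. openin X U \<and> x \<in> U \<and> (U \<subseteq> p ` ?C \<or> U \<inter> p ` ?C = {})" if "x \<in> topspace X" for x
  proof -
    from ec[OF that] obtain U \<V> where U: "x \<in> U" "path_connectedin X U" "evenly_covered E X p U \<V>"
      by (elim exE conjE)
    then have "openin X U" by (simp add: evenly_covered_def)
    then show ?thesis using reach[OF U(2,3)] U(1) by auto
  qed
  have "openin X (p ` ?C)"
  proof (subst openin_subopen, intro ballI)
    fix x assume x: "x \<in> p ` ?C"
    with pC dich[of x] show "\<exists>T. openin X T \<and> x \<in> T \<and> T \<subseteq> p ` ?C" by auto
  qed
  moreover have "openin X (topspace X - p ` ?C)"
  proof (subst openin_subopen, intro ballI)
    fix x assume x: "x \<in> topspace X - p ` ?C"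
    with dich[of x] obtain U where "openin X U" "x \<in> U" "U \<inter> p ` ?C = {}" by auto
    moreover have "U \<subseteq> topspace X" using \<open>openin X U\<close> by (rule openin_subset)
    ultimately show "\<exists>T. openin X T \<and> x \<in> T \<and> T \<subseteq> topspace X - p ` ?C" by auto
  qed
  ultimately have "p ` ?C = topspace X"
    using X bC pC unfolding connected_space_clopen_in closedin_def by blast
  moreover have "\<exists>U \<V>. x \<in> U \<and> evenly_covered (subtopology E ?C) X p U \<V>" if x: "x \<in> topspace X" for x
  proof -
    from ec[OF x] obtain U \<V> where U: "x \<in> U" "path_connectedin X U" "evenly_covered E X p U \<V>"
      by (elim exE conjE)
    note u = U(3)[unfolded evenly_covered_def]
    have "\<Union>{V \<in> \<V>. V \<subseteq> ?C} = {e \<in> topspace (subtopology E ?C). p e \<in> U}"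
    proof
      show "\<Union>{V \<in> \<V>. V \<subseteq> ?C} \<subseteq> {e \<in> topspace (subtopology E ?C). p e \<in> U}"
        using u CE by auto
      show "{e \<in> topspace (subtopology E ?C). p e \<in> U} \<subseteq> \<Union>{V \<in> \<V>. V \<subseteq> ?C}"
      proof
        fix c assume c: "c \<in> {e \<in> topspace (subtopology E ?C). p e \<in> U}"
        then obtain V where "V \<in> \<V>" "c \<in> V" using evenly_covered_obtain_sheet[OF U(3), of c] by auto
        then show "c \<in> \<Union>{V \<in> \<V>. V \<subseteq> ?C}" using sheet_in[OF U(2,3)] c by auto
      qed
    qed
    moreover have "openin (subtopology E ?C) V" if "V \<in> {V \<in> \<V>. V \<subseteq> ?C}" for V
      using that u by (metis (no_types, lifting) mem_Collect_eq openin_subset_topspace_eq 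
         openin_subtopology inf.absorb1)
    moreover have "pairwise disjnt {V \<in> \<V>. V \<subseteq> ?C}" using u by (simp add: pairwise_def)
    moreover have "homeomorphic_map (subtopology (subtopology E ?C) V) (subtopology X U) p"
      if "V \<in> {V \<in> \<V>. V \<subseteq> ?C}" for V
      using that u by (simp add: subtopology_subtopology Int_absorb1)
    ultimately have "evenly_covered (subtopology E ?C) X p U {V \<in> \<V>. V \<subseteq> ?C}"
      using u by (intro evenly_coveredI) auto
    with U(1) show ?thesis by blast
  qed
  moreover have "continuous_map (subtopology E ?C) X p" using p by (rule continuous_map_from_subtopology)
  ultimately show ?thesis unfolding covering_map_evenly_covered using CE by (simp add: Int_absorb1)
qed

lemma covering_map_compose_homeomorphism:
  assumes C: "covering_map C X r" and g: "homeomorphic_map D C g"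
  shows "covering_map D X (r \<circ> g)"
  unfolding covering_map_evenly_covered
proof (intro conjI ballI)
  have gs: "g ` topspace D = topspace C" using homeomorphic_imp_surjective_map[OF g] .
  have gi: "inj_on g (topspace D)" using homeomorphic_imp_injective_map[OF g] .
  show "continuous_map D X (r \<circ> g)"
  proof (rule continuous_map_compose[OF homeomorphic_imp_continuous_map[OF g]])
    show "continuous_map C X r" using C by (simp add: covering_map_def)
  qed
  show "(r \<circ> g) ` topspace D = topspace X"
    using C by (simp only: image_comp[symmetric] gs) (simp add: covering_map_def)
  fix x assume "x \<in> topspace X"
  then obtain U \<V> where U: "x \<in> U" "evenly_covered C X r U \<V>"
    using C unfolding covering_map_evenly_covered by meson
  note u = U(2)[unfolded evenly_covered_def]
  let ?h = "\<lambda>V. {d \<in> topspace D. g d \<in> V}"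
  have "\<Union>(?h ` \<V>) = {d \<in> topspace D. g d \<in> \<Union>\<V>}" by auto
  then have "\<Union>(?h ` \<V>) = {e \<in> topspace D. (r \<circ> g) e \<in> U}" using u gs by auto
  moreover have "openin D (?h V)" if "V \<in> \<V>" for V
    using u that openin_continuous_map_preimage[OF homeomorphic_imp_continuous_map[OF g]] by blast
  moreover have "pairwise disjnt (?h ` \<V>)"
    using u by (fastforce simp: pairwise_def disjnt_iff)
  moreover have "homeomorphic_map (subtopology D (?h V)) (subtopology X U) (r \<circ> g)" if V: "V \<in> \<V>" for V
  proof (rule homeomorphic_map_compose)
    have "V \<subseteq> topspace C" using evenly_covered_sheetD(2)[OF U(2) V] .
    then have "g ` (topspace D \<inter> ?h V) = topspace C \<inter> V" using gs by auto
    then show "homeomorphic_map (subtopology D (?h V)) (subtopology C V) g"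
      by (rule homeomorphic_map_subtopologies[OF g])
    show "homeomorphic_map (subtopology C V) (subtopology X U) r" using u V by blast
  qed
  ultimately have "evenly_covered D X (r \<circ> g) U (?h ` \<V>)" using u unfolding evenly_covered_def by simp
  then show "\<exists>U \<V>. x \<in> U \<and> evenly_covered D X (r \<circ> g) U \<V>" using U(1) by blast
qed

text \<open>
  The defining property of a universal cover speaks only of covers on the type of sets of paths in the
  base. An arbitrary connected cover \<open>C\<close> is moved to that type by sending a point to the projections of
  the paths reaching it from a fixed point; this is injective because \<open>C\<close> is path connected and
  lifts of paths are unique.
\<close>

lemma universal_cover_lift:
  fixes X :: "'a topology" and C :: "'c topology"
  assumes E: "universal_cover X E p" and X: "locally_path_connected_space X"
    and C: "connected_cover X C r"
  obtains f where "continuous_map E C f" "\<And>x. x \<in> topspace E \<Longrightarrow> r (f x) = p x"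
proof -
  have cov: "covering_map C X r" and conn: "connected_space C" using C by (auto simp: connected_cover_def)
  have pc: "path_connected_space C"
    using covering_map_locally_path_connected[OF cov X] conn path_connected_eq_connected_space by blast
  define c0 where "c0 = (SOME c. c \<in> topspace C)"
  define \<iota> where "\<iota> c = {r \<circ> \<gamma> | \<gamma>. pathin C \<gamma> \<and> \<gamma> 0 = c0 \<and> \<gamma> 1 = c}" for c
  have inj: "inj_on \<iota> (topspace C)"
  proof (rule inj_onI)
    fix c d assume c: "c \<in> topspace C" "d \<in> topspace C" "\<iota> c = \<iota> d"
    then have "c0 \<in> topspace C" unfolding c0_def by (metis someI_ex)
    then obtain \<gamma> where g: "pathin C \<gamma>" "\<gamma> 0 = c0" "\<gamma> 1 = c"
      using pc c(1) unfolding path_connected_space_def by metis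
    then have "r \<circ> \<gamma> \<in> \<iota> d" using c(3) unfolding \<iota>_def by blast
    then obtain \<eta> where h: "pathin C \<eta>" "\<eta> 0 = c0" "\<eta> 1 = d" "r \<circ> \<gamma> = r \<circ> \<eta>"
      unfolding \<iota>_def by blast
    have "r (\<gamma> t) = r (\<eta> t)" for t using h(4) by (metis comp_apply)
    then have "\<gamma> 1 = \<eta> 1"
      using continuous_map_lift_agree[OF covering_map_lift_separated[OF cov] connected_Icc, of 0 1 \<gamma> \<eta> 0 1]
        g h by (simp add: pathin_def)
    then show "c = d" using g h by simp
  qed
  let ?D = "quotient_topology C \<iota>"
  have "homeomorphic_map C ?D \<iota>"
    using quotient_map_quotient_topology inj by (auto simp: homeomorphic_map_def)
  then obtain g where g: "homeomorphic_maps C ?D \<iota> g" using homeomorphic_map_maps by blast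
  then have g': "homeomorphic_map ?D C g" by (simp add: homeomorphic_maps_map)
  have "connected_space ?D"
    using conn g' homeomorphic_map_imp_homeomorphic_space homeomorphic_connected_space by blast
  then have "connected_cover X ?D (r \<circ> g)"
    using covering_map_compose_homeomorphism[OF cov g'] by (simp add: connected_cover_def)
  then have "covers E p ?D (r \<circ> g)" using E unfolding universal_cover_def by blast
  then obtain f where f: "covering_map E ?D f" "\<And>x. x \<in> topspace E \<Longrightarrow> (r \<circ> g) (f x) = p x"
    unfolding covers_def by blast
  have "continuous_map E C (g \<circ> f)"
  proof (rule continuous_map_compose[OF _ homeomorphic_imp_continuous_map[OF g']])
    show "continuous_map E ?D f" using f(1) by (simp add: covering_map_def)
  qed
  then show thesis using that f(2) by simp
qed

section \<open>Universal covers are regular\<close>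

text \<open>
  The auxiliary cover. A point over \<open>x\<close> is a map \<open>T\<close> from the fibre of the base point into the fibre of
  \<open>x\<close>; a neighbourhood of \<open>T\<close> consists of the maps obtained by moving all values \<open>T a\<close> simultaneously
  within their sheets over one evenly covered set. In other words this is the fibrewise power of
  \<open>E\<close>, indexed by one of its fibres and with a box-like topology. It covers \<open>X\<close> although an infinite power
  is involved, since a single set is evenly covered for all coordinates at once.
\<close>

locale pointed_covering =
  fixes E :: "'b topology" and X :: "'a topology" and p :: "'b \<Rightarrow> 'a" and e :: 'b
  assumes cov: "covering_map E X p" and lpc: "locally_path_connected_space X"
    and e: "e \<in> topspace E"
begin

definition fib :: "'b set" where
  "fib = {a \<in> topspace E. p a = p e}"

definition fibre_maps :: "('b \<Rightarrow> 'b) set" where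
  "fibre_maps = {T \<in> fib \<rightarrow>\<^sub>E topspace E. \<forall>a \<in> fib. p (T a) = p (T e)}"

definition target :: "('b \<Rightarrow> 'b) \<Rightarrow> 'a" where
  "target T = p (T e)"

definition near :: "'a set \<Rightarrow> ('b \<Rightarrow> 'b) \<Rightarrow> ('b \<Rightarrow> 'b) set" where
  "near U T = {T' \<in> fibre_maps. target T' \<in> U \<and> (\<forall>a \<in> fib. T' a \<in> sheet E p U (T a))}"

lemma p_cont: "continuous_map E X p" using cov by (simp add: covering_map_def)

lemma e_fib: "e \<in> fib" using e by (simp add: fib_def)

lemma fibre_mapsD:
  assumes "T \<in> fibre_maps" "a \<in> fib"
  shows "T a \<in> topspace E" "p (T a) = target T"
  using assms by (auto simp: fibre_maps_def target_def)

lemma target_in: "T \<in> fibre_maps \<Longrightarrow> target T \<in> topspace X"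
  using fibre_mapsD[OF _ e_fib] p_cont by (force simp: continuous_map_def target_def)

lemma near_refl:
  assumes "elementary E X p U" "T \<in> fibre_maps" "target T \<in> U"
  shows "T \<in> near U T"
  unfolding near_def using assms fibre_mapsD[OF assms(2)] sheet_elementary(1)[OF assms(1)] by simp

lemma near_eq:
  assumes U: "elementary E X p U" and T: "T \<in> fibre_maps" "target T \<in> U" and T': "T' \<in> near U T"
  shows "near U T' = near U T"
proof -
  have "sheet E p U (T' a) = sheet E p U (T a)" if a: "a \<in> fib" for a
  proof (rule sheet_elementary(7)[OF U])
    show "T a \<in> topspace E" "p (T a) \<in> U" using fibre_mapsD[OF T(1) a] T(2) by auto
    show "T' a \<in> sheet E p U (T a)" using T' a by (simp add: near_def)
  qed
  then show ?thesis by (auto simp: near_def)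
qed

lemma near_subset:
  assumes U: "elementary E X p U" "elementary E X p U'" "U' \<subseteq> U" and T: "T \<in> fibre_maps" "target T \<in> U'"
  shows "near U' T = {T' \<in> near U T. target T' \<in> U'}"
proof -
  have "sheet E p U' (T a) = {c \<in> sheet E p U (T a). p c \<in> U'}" if a: "a \<in> fib" for a
    using sheet_subset[OF U, of "T a"] fibre_mapsD[OF T(1) a] T(2) p_cont by simp
  then show ?thesis using U(3) fibre_mapsD(2) by (auto simp: near_def)
qed

text \<open>
  A map near \<open>T\<close> is determined by the point it lies over, since sheets contain one point over each
  point of \<open>U\<close>; the inverse picks these points.
\<close>

lemma target_near:
  assumes U: "elementary E X p U" and T: "T \<in> fibre_maps" "target T \<in> U"
  shows "target ` near U T = U" "inj_on target (near U T)"
proof -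
  have Ta: "T a \<in> topspace E" "p (T a) \<in> U" if "a \<in> fib" for a
    using fibre_mapsD[OF T(1) that] T(2) by auto
  note s = sheet_elementary[OF U Ta]
  show "inj_on target (near U T)"
  proof (rule inj_onI)
    fix S S' assume S: "S \<in> near U T" "S' \<in> near U T" "target S = target S'"
    show "S = S'"
    proof (rule PiE_ext)
      show "S \<in> fib \<rightarrow>\<^sub>E topspace E" "S' \<in> fib \<rightarrow>\<^sub>E topspace E"
        using S by (auto simp: near_def fibre_maps_def)
      fix a assume a: "a \<in> fib"
      have "p (S a) = p (S' a)" using S a fibre_mapsD(2) by (simp add: near_def)
      then show "S a = S' a" using inj_onD[OF s(5)[OF a a]] S(1,2) a by (simp add: near_def)
    qed
  qed
  show "target ` near U T = U"
  proof
    show "target ` near U T \<subseteq> U" by (auto simp: near_def)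
    show "U \<subseteq> target ` near U T"
    proof
      fix u assume u: "u \<in> U"
      define S where "S = (\<lambda>a \<in> fib. inv_into (sheet E p U (T a)) p u)"
      have S: "S a \<in> sheet E p U (T a)" "p (S a) = u" if a: "a \<in> fib" for a
        using s(4)[OF a a] u a inv_into_into[of u p "sheet E p U (T a)"]
          f_inv_into_f[of u p "sheet E p U (T a)"] by (auto simp: S_def)
      have "S \<in> fib \<rightarrow>\<^sub>E topspace E" using S(1) s(3) by (auto simp: S_def)
      then have "S \<in> fibre_maps" using S(2) e_fib by (simp add: fibre_maps_def)
      moreover have "target S = u" using S(2) e_fib by (simp add: target_def)
      ultimately have "S \<in> near U T" "u = target S" using S(1) u by (auto simp: near_def)
      then show "u \<in> target ` near U T" by blast
    qed
  qed
qed

definition fibre_maps_top :: "('b \<Rightarrow> 'b) topology" where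
  "fibre_maps_top = topology (\<lambda>W. W \<subseteq> fibre_maps \<and>
     (\<forall>T \<in> W. \<exists>U. elementary E X p U \<and> target T \<in> U \<and> near U T \<subseteq> W))"

lemma openin_fibre_maps_top:
  "openin fibre_maps_top W \<longleftrightarrow> W \<subseteq> fibre_maps \<and>
     (\<forall>T \<in> W. \<exists>U. elementary E X p U \<and> target T \<in> U \<and> near U T \<subseteq> W)"
proof -
  let ?P = "\<lambda>W. W \<subseteq> fibre_maps \<and> (\<forall>T \<in> W. \<exists>U. elementary E X p U \<and> target T \<in> U \<and> near U T \<subseteq> W)"
  have "istopology ?P"
    unfolding istopology_def
  proof (rule conjI; intro allI impI)
    fix S R assume S: "?P S" and R: "?P R"
    have "\<exists>U. elementary E X p U \<and> target T \<in> U \<and> near U T \<subseteq> S \<inter> R" if T: "T \<in> S \<inter> R" for T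
    proof -
      obtain U where U: "elementary E X p U" "target T \<in> U" "near U T \<subseteq> S" using S T by auto
      obtain V where V: "elementary E X p V" "target T \<in> V" "near V T \<subseteq> R" using R T by auto
      \<comment> \<open>Passing to a smaller elementary set shrinks every neighbourhood, which makes intersections of open sets open.\<close>
      have "openin X (U \<inter> V)" using elementary_openin[OF U(1)] elementary_openin[OF V(1)] by (rule openin_Int)
      then obtain W where W: "elementary E X p W" "target T \<in> W" "W \<subseteq> U \<inter> V"
        using elementary_base[OF cov lpc] U(2) V(2) by (metis IntI)
      have "T \<in> fibre_maps" using T S by auto
      then have "near W T \<subseteq> near U T \<inter> near V T"
        using near_subset[OF U(1) W(1) _ _ W(2)] near_subset[OF V(1) W(1) _ _ W(2)] W(3) by auto
      then show ?thesis using W U V by blast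
    qed
    then show "?P (S \<inter> R)" using S by auto
  next
    fix \<K> assume K: "\<forall>K\<in>\<K>. ?P K"
    then show "?P (\<Union>\<K>)" by (meson Sup_least UnionE Union_upper subset_trans)
  qed
  then show ?thesis unfolding fibre_maps_top_def by (simp add: topology_inverse')
qed

lemma topspace_fibre_maps_top: "topspace fibre_maps_top = fibre_maps"
proof
  show "topspace fibre_maps_top \<subseteq> fibre_maps"
    using openin_topspace[of fibre_maps_top] openin_fibre_maps_top by blast
  have "\<exists>U. elementary E X p U \<and> target T \<in> U \<and> near U T \<subseteq> fibre_maps" if T: "T \<in> fibre_maps" for T
  proof -
    obtain U where "elementary E X p U" "target T \<in> U"
      using elementary_base[OF cov lpc openin_topspace target_in[OF T]] by metis
    then show ?thesis by (auto simp: near_def)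
  qed
  then show "fibre_maps \<subseteq> topspace fibre_maps_top"
    by (intro openin_subset) (simp add: openin_fibre_maps_top)
qed

lemma openin_near:
  assumes U: "elementary E X p U" and T: "T \<in> fibre_maps" "target T \<in> U"
  shows "openin fibre_maps_top (near U T)"
  unfolding openin_fibre_maps_top
proof (intro conjI ballI)
  show "near U T \<subseteq> fibre_maps" by (auto simp: near_def)
  fix T' assume T': "T' \<in> near U T"
  then show "\<exists>V. elementary E X p V \<and> target T' \<in> V \<and> near V T' \<subseteq> near U T"
    using near_eq[OF U T T'] U by (auto simp: near_def)
qed

lemma continuous_target: "continuous_map fibre_maps_top X target"
  unfolding continuous_map_def topspace_fibre_maps_top
proof (intro conjI allI impI)
  show "target \<in> fibre_maps \<rightarrow> topspace X" using target_in by auto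
  fix W assume W: "openin X W"
  show "openin fibre_maps_top {T \<in> fibre_maps. target T \<in> W}"
    unfolding openin_fibre_maps_top
  proof (intro conjI ballI)
    fix T assume "T \<in> {T \<in> fibre_maps. target T \<in> W}"
    then obtain U where "elementary E X p U" "target T \<in> U" "U \<subseteq> W"
      using elementary_base[OF cov lpc W] by auto
    then show "\<exists>U. elementary E X p U \<and> target T \<in> U \<and> near U T \<subseteq> {T \<in> fibre_maps. target T \<in> W}"
      by (auto simp: near_def)
  qed auto
qed

lemma near_homeomorphic:
  assumes U: "elementary E X p U" and T: "T \<in> fibre_maps" "target T \<in> U"
  shows "homeomorphic_map (subtopology fibre_maps_top (near U T)) (subtopology X U) target"
proof (rule bijective_open_imp_homeomorphic_map)
  have UX: "openin X U" "U \<subseteq> topspace X" using elementary_openin[OF U] openin_subset by auto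
  have N: "near U T \<subseteq> topspace fibre_maps_top"
    using topspace_fibre_maps_top by (auto simp: near_def)
  note t = target_near[OF U T]
  show "continuous_map (subtopology fibre_maps_top (near U T)) (subtopology X U) target"
    using continuous_map_from_subtopology[OF continuous_target] t(1)
    by (auto simp: continuous_map_in_subtopology)
  show "target ` topspace (subtopology fibre_maps_top (near U T)) = topspace (subtopology X U)"
    using t(1) N UX by (simp add: Int_absorb1)
  show "inj_on target (topspace (subtopology fibre_maps_top (near U T)))"
    using t(2) N by (simp add: Int_absorb1)
  show "open_map (subtopology fibre_maps_top (near U T)) (subtopology X U) target"
    unfolding open_map_def
  proof (intro allI impI)
    fix W assume "openin (subtopology fibre_maps_top (near U T)) W"
    then have W: "openin fibre_maps_top W" "W \<subseteq> near U T"
      using openin_open_subtopology[OF openin_near[OF U T]] by auto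
    have "openin X (target ` W)"
    proof (subst openin_subopen, intro ballI)
      fix x assume "x \<in> target ` W"
      then obtain S where S: "S \<in> W" "x = target S" by auto
      then obtain V where V: "elementary E X p V" "target S \<in> V" "near V S \<subseteq> W"
        using W(1) unfolding openin_fibre_maps_top by blast
      have "S \<in> fibre_maps" using S W by (auto simp: near_def)
      then have "V = target ` near V S" using target_near(1)[OF V(1) _ V(2)] by simp
      then have "V \<subseteq> target ` W" using V(3) by blast
      then show "\<exists>V. openin X V \<and> x \<in> V \<and> V \<subseteq> target ` W"
        using V(2) S(2) elementary_openin[OF V(1)] by auto
    qed
    moreover have "target ` W \<subseteq> U" using W(2) t(1) by blast
    ultimately show "openin (subtopology X U) (target ` W)"
      using openin_open_subtopology[OF UX(1)] by blast
  qed
qed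

lemma target_evenly_covered:
  assumes U: "elementary E X p U"
  shows "evenly_covered fibre_maps_top X target U (near U ` {T \<in> fibre_maps. target T \<in> U})"
proof (rule evenly_coveredI)
  let ?V = "near U ` {T \<in> fibre_maps. target T \<in> U}"
  show "openin X U" using elementary_openin[OF U] .
  have "\<Union>?V \<subseteq> {T \<in> fibre_maps. target T \<in> U}" by (auto simp: near_def)
  moreover have "{T \<in> fibre_maps. target T \<in> U} \<subseteq> \<Union>?V" using near_refl[OF U] by blast
  ultimately show "\<Union>?V = {T \<in> topspace fibre_maps_top. target T \<in> U}"
    by (simp add: topspace_fibre_maps_top)
  show "openin fibre_maps_top V" if V: "V \<in> ?V" for V
  proof -
    obtain T where "T \<in> fibre_maps" "target T \<in> U" "V = near U T" using V by auto
    then show ?thesis using openin_near[OF U] by simp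
  qed
  show "homeomorphic_map (subtopology fibre_maps_top V) (subtopology X U) target" if V: "V \<in> ?V" for V
  proof -
    obtain T where "T \<in> fibre_maps" "target T \<in> U" "V = near U T" using V by auto
    then show ?thesis using near_homeomorphic[OF U] by simp
  qed
  show "pairwise disjnt ?V"
  proof (rule pairwiseI)
    fix N M assume "N \<in> ?V" "M \<in> ?V" and NM: "N \<noteq> M"
    then obtain T S where T: "T \<in> fibre_maps" "target T \<in> U" "N = near U T"
      and S: "S \<in> fibre_maps" "target S \<in> U" "M = near U S" by auto
    show "disjnt N M"
    proof (rule ccontr)
      assume "\<not> disjnt N M"
      then obtain R where "R \<in> N" "R \<in> M" by (auto simp: disjnt_iff)
      then show False using near_eq[OF U T(1,2), of R] near_eq[OF U S(1,2), of R] T S NM by simp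
    qed
  qed
qed

lemma continuous_evaluation:
  assumes a: "a \<in> fib"
  shows "continuous_map fibre_maps_top E (\<lambda>T. T a)"
  unfolding continuous_map_def topspace_fibre_maps_top
proof (intro conjI allI impI)
  show "(\<lambda>T. T a) \<in> fibre_maps \<rightarrow> topspace E" using fibre_mapsD(1)[OF _ a] by auto
  fix W assume W: "openin E W"
  show "openin fibre_maps_top {T \<in> fibre_maps. T a \<in> W}"
    unfolding openin_fibre_maps_top
  proof (intro conjI ballI)
    fix T assume T: "T \<in> {T \<in> fibre_maps. T a \<in> W}"
    then obtain U where U: "elementary E X p U" "p (T a) \<in> U" "sheet E p U (T a) \<subseteq> W"
      using sheet_base[OF cov lpc W] by auto
    have "target T \<in> U" using U(2) T fibre_mapsD(2)[OF _ a] by simp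
    moreover have "near U T \<subseteq> {T \<in> fibre_maps. T a \<in> W}" using U(3) a by (auto simp: near_def)
    ultimately show "\<exists>U. elementary E X p U \<and> target T \<in> U \<and> near U T \<subseteq> {T \<in> fibre_maps. T a \<in> W}"
      using U(1) by blast
  qed auto
qed

text \<open>
  Moving within sheets matches the fibres of nearby points bijectively, so being onto is preserved in
  both directions and defines a clopen set. Every member of the component of the identity is
  therefore onto.
\<close>

definition onto_fibre :: "('b \<Rightarrow> 'b) set" where
  "onto_fibre = {T \<in> fibre_maps. \<forall>y \<in> topspace E. p y = target T \<longrightarrow> y \<in> T ` fib}"

lemma onto_fibre_near:
  assumes U: "elementary E X p U" and T: "T \<in> onto_fibre" "target T \<in> U" and S: "S \<in> near U T"
  shows "S \<in> onto_fibre"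
proof -
  have Tf: "T \<in> fibre_maps" and Sf: "S \<in> fibre_maps" and SU: "target S \<in> U"
    using T(1) S by (auto simp: onto_fibre_def near_def)
  have "y \<in> S ` fib" if y: "y \<in> topspace E" "p y = target S" for y
  proof -
    have pyU: "p y \<in> U" using y(2) SU by simp
    note s = sheet_elementary[OF U y(1) pyU]
    obtain z where z: "z \<in> sheet E p U y" "p z = target T" using s(4) T(2) by (metis imageE)
    then have "z \<in> T ` fib" using T(1) s(3) by (auto simp: onto_fibre_def)
    then obtain a where a: "a \<in> fib" "z = T a" by auto
    have "S a \<in> sheet E p U y" using S a z(1) s(7) by (auto simp: near_def)
    moreover have "p (S a) = p y" using fibre_mapsD(2)[OF Sf a(1)] y by simp
    ultimately have "S a = y" using inj_onD[OF s(5)] s(1) by metis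
    then show ?thesis using a by blast
  qed
  then show ?thesis using Sf by (auto simp: onto_fibre_def)
qed

lemma onto_fibre_clopen: "openin fibre_maps_top onto_fibre" "closedin fibre_maps_top onto_fibre"
proof -
  have el: "\<exists>U. elementary E X p U \<and> target T \<in> U" if "T \<in> fibre_maps" for T
    using elementary_base[OF cov lpc openin_topspace target_in[OF that]] by metis
  show "openin fibre_maps_top onto_fibre"
    unfolding openin_fibre_maps_top
  proof (intro conjI ballI)
    show "onto_fibre \<subseteq> fibre_maps" by (auto simp: onto_fibre_def)
    fix T assume T: "T \<in> onto_fibre"
    then obtain U where U: "elementary E X p U" "target T \<in> U" using el by (auto simp: onto_fibre_def)
    then show "\<exists>U. elementary E X p U \<and> target T \<in> U \<and> near U T \<subseteq> onto_fibre"
      using onto_fibre_near[OF U(1) T U(2)] by blast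
  qed
  have "openin fibre_maps_top (fibre_maps - onto_fibre)"
    unfolding openin_fibre_maps_top
  proof (intro conjI ballI)
    fix T assume T: "T \<in> fibre_maps - onto_fibre"
    then obtain U where U: "elementary E X p U" "target T \<in> U" using el by auto
    have "S \<notin> onto_fibre" if S: "S \<in> near U T" for S
    proof
      assume S': "S \<in> onto_fibre"
      have "near U S = near U T" using near_eq[OF U(1) _ U(2) S] T by blast
      then have "T \<in> near U S" using near_refl[OF U(1) _ U(2)] T by auto
      moreover have "target S \<in> U" using S by (simp add: near_def)
      ultimately show False using onto_fibre_near[OF U(1) S'] T by blast
    qed
    then have "near U T \<subseteq> fibre_maps - onto_fibre" by (auto simp: near_def)
    then show "\<exists>U. elementary E X p U \<and> target T \<in> U \<and> near U T \<subseteq> fibre_maps - onto_fibre"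
      using U by blast
  qed auto
  then show "closedin fibre_maps_top onto_fibre"
    by (auto simp: closedin_def topspace_fibre_maps_top onto_fibre_def)
qed

text \<open>
  A map \<open>f\<close> from \<open>E\<close> to the component of the identity sends \<open>e\<close> to a map \<open>f e\<close> of the fibre onto itself.
  With \<open>f e a = b\<close>, the composition of \<open>f\<close> with evaluation at \<open>a\<close> is the required map.
\<close>

lemma exists_self_map:
  assumes univ: "universal_cover X E p" and b: "b \<in> fib"
  obtains \<phi> where "continuous_map E E \<phi>" "\<And>x. x \<in> topspace E \<Longrightarrow> p (\<phi> x) = p x" "\<phi> e = b"
proof -
  \<comment> \<open>The base point of the auxiliary cover: the identity of the fibre.\<close>
  define T0 where "T0 = (\<lambda>a \<in> fib. a)"
  have T0: "T0 \<in> fibre_maps" using e_fib by (auto simp: T0_def fibre_maps_def fib_def)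
  let ?C = "connected_component_of_set fibre_maps_top T0"
  let ?S = "subtopology fibre_maps_top ?C"
  have T0C: "T0 \<in> ?C" using T0 by (simp add: connected_component_of_refl topspace_fibre_maps_top)
  have conn: "connected_space E" using univ by (simp add: universal_cover_def connected_cover_def)
  have "connected_space X"
    using conn cov connectedin_continuous_map_image[OF p_cont, of "topspace E"]
    by (simp add: covering_map_def connectedin_topspace)
  moreover have "\<exists>U \<V>. x \<in> U \<and> path_connectedin X U \<and> evenly_covered fibre_maps_top X target U \<V>"
    if x: "x \<in> topspace X" for x
  proof -
    obtain U where U: "elementary E X p U" "x \<in> U" using elementary_base[OF cov lpc openin_topspace x] by metis
    then have "path_connectedin X U" by (simp add: elementary_def)
    then show ?thesis using target_evenly_covered[OF U(1)] U(2) by (intro exI conjI)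
  qed
  ultimately have "covering_map ?S X target"
    using covering_map_component[OF continuous_target] T0 topspace_fibre_maps_top by metis
  then have "connected_cover X ?S target"
    by (simp add: connected_cover_def connectedin_connected_component_of connected_space_subtopology)
  then obtain f where f: "continuous_map E ?S f" "\<And>x. x \<in> topspace E \<Longrightarrow> target (f x) = p x"
    using universal_cover_lift[OF univ lpc] by metis
  have fC: "f x \<in> ?C" "f x \<in> fibre_maps" if "x \<in> topspace E" for x
    using f(1) that topspace_fibre_maps_top by (auto simp: continuous_map_def)
  have "T0 \<in> onto_fibre" using T0 e_fib
    by (force simp: onto_fibre_def T0_def fib_def target_def)
  then have "?C \<subseteq> onto_fibre"
    using connectedin_clopen_cases[OF connectedin_connected_component_of onto_fibre_clopen(2,1)] T0C
    by (meson disjnt_iff)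
  then have "f e \<in> onto_fibre" using fC e by blast
  then have "b \<in> f e ` fib" using b f(2)[OF e] by (auto simp: onto_fibre_def fib_def)
  then obtain a where a: "a \<in> fib" "f e a = b" by auto
  have "continuous_map E fibre_maps_top f" using f(1) by (simp add: continuous_map_in_subtopology)
  from continuous_map_compose[OF this continuous_evaluation[OF a(1)]]
  have "continuous_map E E (\<lambda>x. f x a)" by (simp add: o_def)
  moreover have "p (f x a) = p x" if "x \<in> topspace E" for x
    using fibre_mapsD(2)[OF fC(2)[OF that] a(1)] f(2)[OF that] by simp
  ultimately show thesis using that a(2) by blast
qed

end

text \<open>
  The self maps moving \<open>a\<close> to \<open>b\<close> and \<open>b\<close> to \<open>a\<close> are inverse to each other by uniqueness of lifts.
\<close>

lemma universal_cover_regular: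
  assumes univ: "universal_cover X E p" and X: "locally_path_connected_space X"
    and ab: "a \<in> topspace E" "b \<in> topspace E" "p a = p b"
  obtains \<phi> where "\<phi> \<in> deck_transformations E p" "\<phi> a = b"
proof -
  have cov: "covering_map E X p" and conn: "connected_space E"
    using univ by (auto simp: universal_cover_def connected_cover_def)
  interpret a: pointed_covering E X p a using cov X ab by unfold_locales
  interpret b: pointed_covering E X p b using cov X ab by unfold_locales
  obtain f where f: "continuous_map E E f" "\<And>x. x \<in> topspace E \<Longrightarrow> p (f x) = p x" "f a = b"
    using a.exists_self_map[OF univ, of b] ab by (auto simp: a.fib_def)
  obtain g where g: "continuous_map E E g" "\<And>x. x \<in> topspace E \<Longrightarrow> p (g x) = p x" "g b = a"
    using b.exists_self_map[OF univ, of a] ab by (auto simp: b.fib_def)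
  have fE: "f x \<in> topspace E" and gE: "g x \<in> topspace E" if "x \<in> topspace E" for x
    using that f(1) g(1) by (auto simp: continuous_map_def)
  note agree = lifts_agree[OF covering_map_lift_separated[OF cov] conn]
  have gf: "g (f x) = x" if "x \<in> topspace E" for x
    using agree[OF continuous_map_compose[OF f(1) g(1)] continuous_map_id, of a x] that f g ab fE
    by simp
  have fg: "f (g x) = x" if "x \<in> topspace E" for x
    using agree[OF continuous_map_compose[OF g(1) f(1)] continuous_map_id, of b x] that f g ab gE
    by simp
  have "homeomorphic_maps E E f g" using f g gf fg by (simp add: homeomorphic_maps_def)
  then have "homeomorphic_map E E f" by (simp add: homeomorphic_maps_map)
  then have "homeomorphic_map E E (restrict f (topspace E))"
    by (rule homeomorphic_map_eq) simp
  then have "restrict f (topspace E) \<in> deck_transformations E p"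
    using f by (simp add: deck_transformations_def)
  then show thesis using that f(3) ab(1) by simp
qed

section \<open>The fundamental group of an abstract topology\<close>

abbreviation path_homotopic :: "'a topology \<Rightarrow> 'a \<Rightarrow> 'a \<Rightarrow> (real \<Rightarrow> 'a) \<Rightarrow> (real \<Rightarrow> 'a) \<Rightarrow> bool" where
  "path_homotopic X x y \<equiv> homotopic_with (\<lambda>h. h 0 = x \<and> h 1 = y) (top_of_set {0..1}) X"

lemma path_homotopic_refl: "path_homotopic X x y \<gamma> \<gamma> \<longleftrightarrow> pathin X \<gamma> \<and> \<gamma> 0 = x \<and> \<gamma> 1 = y"
  by (simp add: pathin_def)

lemma path_homotopic_imp_pathin:
  assumes "path_homotopic X x y \<gamma> \<eta>"
  shows "pathin X \<gamma> \<and> \<gamma> 0 = x \<and> \<gamma> 1 = y" "pathin X \<eta> \<and> \<eta> 0 = x \<and> \<eta> 1 = y"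
  using homotopic_with_imp_continuous_maps[OF assms] homotopic_with_imp_property[OF assms]
  by (auto simp: pathin_def)

lemma path_homotopic_cong:
  assumes "pathin X \<gamma>" "\<gamma> 0 = x" "\<gamma> 1 = y" "\<And>t. t \<in> {0..1} \<Longrightarrow> \<gamma> t = \<eta> t"
  shows "path_homotopic X x y \<gamma> \<eta>"
  using assms by (intro homotopic_with_equal) (auto simp: pathin_def)

lemma path_homotopic_concat:
  assumes "path_homotopic X x y \<gamma> \<gamma>'" "path_homotopic X y z \<eta> \<eta>'"
  shows "path_homotopic X x z (concat_paths \<gamma> \<eta>) (concat_paths \<gamma>' \<eta>')"
proof -
  let ?I = "top_of_set {0..1::real}"
  let ?Q = "prod_topology ?I ?I"
  obtain h :: "real \<times> real \<Rightarrow> _" where h: "continuous_map ?Q X h"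
    "\<forall>t. h (0, t) = \<gamma> t" "\<forall>t. h (1, t) = \<gamma>' t" "\<forall>s\<in>{0..1}. h (s, 0) = x \<and> h (s, 1) = y"
    using assms(1) unfolding homotopic_with_def by blast
  obtain k :: "real \<times> real \<Rightarrow> _" where k: "continuous_map ?Q X k"
    "\<forall>t. k (0, t) = \<eta> t" "\<forall>t. k (1, t) = \<eta>' t" "\<forall>s\<in>{0..1}. k (s, 0) = y \<and> k (s, 1) = z"
    using assms(2) unfolding homotopic_with_def by blast
  let ?m = "\<lambda>w. if snd w \<le> 1/2 then (h \<circ> (\<lambda>w. (fst w, 2 * snd w))) w else (k \<circ> (\<lambda>w. (fst w, 2 * snd w - 1))) w"
  have Q: "?Q = top_of_set ({0..1} \<times> {0..1})" by (simp add: prod_topology_subtopology_eu)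
  have "continuous_map ?Q X ?m"
  proof (rule continuous_map_cases_le)
    show "continuous_map ?Q euclideanreal snd" "continuous_map ?Q euclideanreal (\<lambda>w. 1/2)"
      unfolding Q by (auto intro: continuous_intros)
    show "continuous_map (subtopology ?Q {w \<in> topspace ?Q. snd w \<le> 1/2}) X (h \<circ> (\<lambda>w. (fst w, 2 * snd w)))"
    proof (rule continuous_map_compose[OF _ h(1)])
      show "continuous_map (subtopology ?Q {w \<in> topspace ?Q. snd w \<le> 1/2}) ?Q (\<lambda>w. (fst w, 2 * snd w))"
        unfolding Q subtopology_subtopology
        by (auto simp: continuous_map_in_subtopology intro!: continuous_intros)
    qed
    show "continuous_map (subtopology ?Q {w \<in> topspace ?Q. 1/2 \<le> snd w}) X (k \<circ> (\<lambda>w. (fst w, 2 * snd w - 1)))"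
    proof (rule continuous_map_compose[OF _ k(1)])
      show "continuous_map (subtopology ?Q {w \<in> topspace ?Q. 1/2 \<le> snd w}) ?Q (\<lambda>w. (fst w, 2 * snd w - 1))"
        unfolding Q subtopology_subtopology
        by (auto simp: continuous_map_in_subtopology intro!: continuous_intros)
    qed
    fix w assume "w \<in> topspace ?Q" "snd w = 1/2"
    then obtain s where "w = (s, 1/2)" "s \<in> {0..1}" by (cases w) auto
    then show "(h \<circ> (\<lambda>w. (fst w, 2 * snd w))) w = (k \<circ> (\<lambda>w. (fst w, 2 * snd w - 1))) w"
      using h(4) k(4) by auto
  qed
  then show ?thesis
    unfolding homotopic_with_def
    by (intro exI[of _ ?m]) (use h k in \<open>auto simp: concat_paths_def\<close>)
qed

text \<open>
  The homotopies needed for the group laws are reparametrisations. They take place in the unit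
  interval, and composing with the path in question transports them to any topology.
\<close>

lemma path_homotopic_compose:
  assumes "pathin X \<gamma>" "homotopic_paths {0..1} u v"
  shows "path_homotopic X (\<gamma> (u 0)) (\<gamma> (u 1)) (\<gamma> \<circ> u) (\<gamma> \<circ> v)"
  using assms unfolding homotopic_paths_def pathin_def
  by (elim homotopic_with_compose_continuous_map_left) (auto simp: pathstart_def pathfinish_def)

lemma compose_joinpaths: "\<gamma> \<circ> (u +++ v) = concat_paths (\<gamma> \<circ> u) (\<gamma> \<circ> v)"
  by (auto simp: concat_paths_def joinpaths_def)

lemma joinpaths_endpoints: "(u +++ v) 0 = u 0" "(u +++ v) 1 = v 1"
  by (auto simp: joinpaths_def)

lemma compose_linepath: "\<gamma> \<circ> linepath 0 1 = \<gamma>" for \<gamma> :: "real \<Rightarrow> 'a"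
  by (auto simp: linepath_def)

lemma linepath_in_unit: "a \<in> {0..1} \<Longrightarrow> b \<in> {0..1} \<Longrightarrow> path_image (linepath a b) \<subseteq> {0..1::real}"
  by (simp add: closed_segment_subset path_image_linepath)

lemma path_homotopic_const_concat:
  assumes "pathin X \<gamma>"
  shows "path_homotopic X (\<gamma> 0) (\<gamma> 1) (concat_paths (\<lambda>t. \<gamma> 0) \<gamma>) \<gamma>"
proof -
  have "homotopic_paths {0..1::real} (linepath 0 0 +++ linepath 0 1) (linepath 0 1)"
    using homotopic_paths_lid[of "linepath 0 (1::real)" "{0..1}"] linepath_in_unit[of 0 1] by simp
  from path_homotopic_compose[OF assms this]
  have "path_homotopic X (\<gamma> 0) (\<gamma> 1) (concat_paths (\<gamma> \<circ> linepath 0 0) \<gamma>) \<gamma>"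
    by (simp add: compose_joinpaths compose_linepath joinpaths_endpoints linepath_0' linepath_1')
  moreover have "\<gamma> \<circ> linepath 0 0 = (\<lambda>t. \<gamma> 0)" by (auto simp: linepath_def)
  ultimately show ?thesis by simp
qed

lemma path_homotopic_reverse_concat:
  assumes "pathin X \<gamma>"
  shows "path_homotopic X (\<gamma> 1) (\<gamma> 1) (concat_paths (\<lambda>t. \<gamma> (1 - t)) \<gamma>) (\<lambda>t. \<gamma> 1)"
proof -
  have "homotopic_paths {0..1::real} (linepath 1 0 +++ linepath 0 1) (linepath 1 1)"
    using homotopic_paths_linv[of "linepath 0 (1::real)" "{0..1}"] linepath_in_unit[of 0 1] by simp
  from path_homotopic_compose[OF assms this]
  have "path_homotopic X (\<gamma> 1) (\<gamma> 1) (concat_paths (\<gamma> \<circ> linepath 1 0) \<gamma>) (\<gamma> \<circ> linepath 1 1)"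
    by (simp add: compose_joinpaths compose_linepath joinpaths_endpoints linepath_0' linepath_1')
  moreover have "\<gamma> \<circ> linepath 1 1 = (\<lambda>t. \<gamma> 1)" "\<gamma> \<circ> linepath 1 0 = (\<lambda>t. \<gamma> (1 - t))"
    by (auto simp: linepath_def)
  ultimately show ?thesis by simp
qed

lemma pathin_concat:
  assumes "pathin X \<gamma>" "pathin X \<eta>" "\<gamma> 1 = \<eta> 0"
  shows "pathin X (concat_paths \<gamma> \<eta>)"
proof -
  have "path_homotopic X (\<gamma> 0) (\<gamma> 1) \<gamma> \<gamma>" "path_homotopic X (\<gamma> 1) (\<eta> 1) \<eta> \<eta>"
    unfolding path_homotopic_refl using assms by auto
  from path_homotopic_imp_pathin(1)[OF path_homotopic_concat[OF this]] show ?thesis by simp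
qed

lemma pathin_reverse: "pathin X \<gamma> \<Longrightarrow> pathin X (\<lambda>t. \<gamma> (1 - t))"
proof -
  assume "pathin X \<gamma>"
  moreover have "continuous_map (top_of_set {0..1}) (top_of_set {0..1}) (\<lambda>t::real. 1 - t)"
    by (auto simp: continuous_map_in_subtopology intro!: continuous_intros)
  ultimately have "continuous_map (top_of_set {0..1}) X (\<gamma> \<circ> (\<lambda>t. 1 - t))"
    unfolding pathin_def by (rule continuous_map_compose[rotated])
  then show ?thesis by (simp add: pathin_def o_def)
qed

text \<open>
  Both sides are the path \<open>\<gamma> (\<eta> \<zeta>)\<close> composed with a concatenation of the linear paths between
  \<open>0\<close>, \<open>1/2\<close>, \<open>3/4\<close> and \<open>1\<close>, bracketed in the two possible ways.
\<close>

lemma path_homotopic_concat_assoc: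
  assumes "pathin X \<gamma>" "pathin X \<eta>" "pathin X \<zeta>" "\<gamma> 1 = \<eta> 0" "\<eta> 1 = \<zeta> 0"
  shows "path_homotopic X (\<gamma> 0) (\<zeta> 1) (concat_paths \<gamma> (concat_paths \<eta> \<zeta>)) (concat_paths (concat_paths \<gamma> \<eta>) \<zeta>)"
proof -
  let ?u = "linepath 0 (1/2) :: real \<Rightarrow> real" and ?v = "linepath (1/2) (3/4) :: real \<Rightarrow> real"
    and ?w = "linepath (3/4) 1 :: real \<Rightarrow> real"
  let ?\<omega> = "concat_paths \<gamma> (concat_paths \<eta> \<zeta>)"
  have c0: "concat_paths a b 0 = a 0" and c1: "concat_paths a b 1 = b 1" for a b :: "real \<Rightarrow> 'a"
    by (auto simp: concat_paths_def)
  have \<omega>: "pathin X ?\<omega>" by (intro pathin_concat assms) (simp add: c0 assms)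
  have "homotopic_paths {0..1::real} (?u +++ (?v +++ ?w)) ((?u +++ ?v) +++ ?w)"
    by (intro homotopic_paths_assoc linepath_in_unit) auto
  from path_homotopic_compose[OF \<omega> this]
  have 1: "path_homotopic X (\<gamma> 0) (\<zeta> 1) (concat_paths (?\<omega> \<circ> ?u) (concat_paths (?\<omega> \<circ> ?v) (?\<omega> \<circ> ?w)))
      (concat_paths (concat_paths (?\<omega> \<circ> ?u) (?\<omega> \<circ> ?v)) (?\<omega> \<circ> ?w))"
    by (simp add: compose_joinpaths joinpaths_endpoints linepath_0' linepath_1' c0 c1)
  have u: "(?\<omega> \<circ> ?u) t = \<gamma> t" and v: "(?\<omega> \<circ> ?v) t = \<eta> t" and w: "(?\<omega> \<circ> ?w) t = \<zeta> t" if "t \<in> {0..1}" for t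
    using that assms(4,5) by (auto simp: concat_paths_def linepath_def field_simps)
  have "path_homotopic X (\<gamma> 0) (\<zeta> 1) ?\<omega> (concat_paths (?\<omega> \<circ> ?u) (concat_paths (?\<omega> \<circ> ?v) (?\<omega> \<circ> ?w)))"
    by (rule path_homotopic_cong[OF \<omega>]) (use u v w in \<open>auto simp: concat_paths_def\<close>)
  moreover have "path_homotopic X (\<gamma> 0) (\<zeta> 1)
       (concat_paths (concat_paths (?\<omega> \<circ> ?u) (?\<omega> \<circ> ?v)) (?\<omega> \<circ> ?w)) (concat_paths (concat_paths \<gamma> \<eta>) \<zeta>)"
    by (rule path_homotopic_cong)
      (use path_homotopic_imp_pathin(2)[OF 1] u v w in \<open>auto simp: concat_paths_def\<close>)
  ultimately show ?thesis using 1 homotopic_with_trans by blast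
qed

lemma loop_class_eq:
  assumes "path_homotopic X x x \<gamma> \<eta>"
  shows "loop_class X x \<gamma> = loop_class X x \<eta>"
  using assms homotopic_with_trans homotopic_with_symD unfolding loop_class_def by blast

lemma loop_class_self: "\<gamma> \<in> loops_at X x \<Longrightarrow> \<gamma> \<in> loop_class X x \<gamma>"
  by (simp add: loop_class_def loops_at_def pathin_def)

lemma in_carrier_fundamental_group:
  assumes "g \<in> carrier (fundamental_group X x)" "\<gamma> \<in> g"
  shows "\<gamma> \<in> loops_at X x" "g = loop_class X x \<gamma>"
proof -
  obtain \<gamma>0 where g: "\<gamma>0 \<in> loops_at X x" "g = loop_class X x \<gamma>0"
    using assms by (auto simp: fundamental_group_def)
  then have h: "path_homotopic X x x \<gamma>0 \<gamma>" using assms by (simp add: loop_class_def)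
  show "\<gamma> \<in> loops_at X x" using path_homotopic_imp_pathin(2)[OF h] by (simp add: loops_at_def)
  show "g = loop_class X x \<gamma>" using loop_class_eq[OF h] g by simp
qed

lemma carrier_fundamental_group_obtain:
  assumes "g \<in> carrier (fundamental_group X x)"
  obtains \<gamma> where "\<gamma> \<in> g" "\<gamma> \<in> loops_at X x" "g = loop_class X x \<gamma>"
proof -
  obtain \<gamma> where "\<gamma> \<in> loops_at X x" "g = loop_class X x \<gamma>"
    using assms by (auto simp: fundamental_group_def)
  then show thesis using that[of \<gamma>] loop_class_self[of \<gamma> X x] by simp
qed

lemma fundamental_group_mult:
  assumes "\<gamma> \<in> loops_at X x" "\<eta> \<in> loops_at X x"
  shows "loop_class X x \<gamma> \<otimes>\<^bsub>fundamental_group X x\<^esub> loop_class X x \<eta> = loop_class X x (concat_paths \<gamma> \<eta>)"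
proof -
  have "loop_class X x (concat_paths \<gamma>' \<eta>') = loop_class X x (concat_paths \<gamma> \<eta>)"
    if "\<gamma>' \<in> loop_class X x \<gamma>" "\<eta>' \<in> loop_class X x \<eta>" for \<gamma>' \<eta>'
  proof (rule loop_class_eq[symmetric, OF path_homotopic_concat])
    show "path_homotopic X x x \<gamma> \<gamma>'" "path_homotopic X x x \<eta> \<eta>'" using that by (simp_all add: loop_class_def)
  qed
  then have "(\<Union>\<gamma>'\<in>loop_class X x \<gamma>. \<Union>\<eta>'\<in>loop_class X x \<eta>. loop_class X x (concat_paths \<gamma>' \<eta>'))
      = (\<Union>\<gamma>'\<in>loop_class X x \<gamma>. \<Union>\<eta>'\<in>loop_class X x \<eta>. loop_class X x (concat_paths \<gamma> \<eta>))"
    by simp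
  also have "\<dots> = loop_class X x (concat_paths \<gamma> \<eta>)"
    using loop_class_self[OF assms(1)] loop_class_self[OF assms(2)] by blast
  finally show ?thesis by (simp add: fundamental_group_def)
qed

lemma concat_loops: "\<gamma> \<in> loops_at X x \<Longrightarrow> \<eta> \<in> loops_at X x \<Longrightarrow> concat_paths \<gamma> \<eta> \<in> loops_at X x"
  using pathin_concat[of X \<gamma> \<eta>] by (auto simp: loops_at_def concat_paths_def)

lemma loop_class_in_carrier: "\<gamma> \<in> loops_at X x \<Longrightarrow> loop_class X x \<gamma> \<in> carrier (fundamental_group X x)"
  by (simp add: fundamental_group_def)

lemma fundamental_group_one: "\<one>\<^bsub>fundamental_group X x\<^esub> = loop_class X x (\<lambda>t. x)"
  by (simp add: fundamental_group_def)

lemma group_fundamental_group: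
  assumes x: "x \<in> topspace X"
  shows "group (fundamental_group X x)"
proof (rule groupI)
  let ?G = "fundamental_group X x"
  have const: "(\<lambda>t. x) \<in> loops_at X x" using x by (simp add: loops_at_def)
  show "\<one>\<^bsub>?G\<^esub> \<in> carrier ?G"
    using const by (simp add: fundamental_group_one loop_class_in_carrier)
  fix g assume "g \<in> carrier ?G"
  then obtain \<gamma> where g: "\<gamma> \<in> loops_at X x" "g = loop_class X x \<gamma>"
    using carrier_fundamental_group_obtain by metis
  then have \<gamma>: "pathin X \<gamma>" "\<gamma> 0 = x" "\<gamma> 1 = x" by (auto simp: loops_at_def)
  show "\<one>\<^bsub>?G\<^esub> \<otimes>\<^bsub>?G\<^esub> g = g"
    using loop_class_eq[OF path_homotopic_const_concat[OF \<gamma>(1), unfolded \<gamma>(2,3)]] g const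
    by (simp add: fundamental_group_one fundamental_group_mult)
  have rev: "(\<lambda>t. \<gamma> (1 - t)) \<in> loops_at X x" using pathin_reverse[OF \<gamma>(1)] \<gamma> by (simp add: loops_at_def)
  have "loop_class X x (\<lambda>t. \<gamma> (1 - t)) \<otimes>\<^bsub>?G\<^esub> g = \<one>\<^bsub>?G\<^esub>"
    using loop_class_eq[OF path_homotopic_reverse_concat[OF \<gamma>(1), unfolded \<gamma>(3)]] g rev
    by (simp add: fundamental_group_one fundamental_group_mult)
  then show "\<exists>h\<in>carrier ?G. h \<otimes>\<^bsub>?G\<^esub> g = \<one>\<^bsub>?G\<^esub>" using loop_class_in_carrier[OF rev] by blast
  fix h assume "h \<in> carrier ?G"
  then obtain \<eta> where h: "\<eta> \<in> loops_at X x" "h = loop_class X x \<eta>"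
    using carrier_fundamental_group_obtain by metis
  show "g \<otimes>\<^bsub>?G\<^esub> h \<in> carrier ?G"
    using g h by (simp add: fundamental_group_mult loop_class_in_carrier concat_loops)
  fix k assume "k \<in> carrier ?G"
  then obtain \<zeta> where k: "\<zeta> \<in> loops_at X x" "k = loop_class X x \<zeta>"
    using carrier_fundamental_group_obtain by metis
  have "path_homotopic X x x (concat_paths \<gamma> (concat_paths \<eta> \<zeta>)) (concat_paths (concat_paths \<gamma> \<eta>) \<zeta>)"
    using path_homotopic_concat_assoc[of X \<gamma> \<eta> \<zeta>] g(1) h(1) k(1) by (simp add: loops_at_def)
  from loop_class_eq[OF this] show "g \<otimes>\<^bsub>?G\<^esub> h \<otimes>\<^bsub>?G\<^esub> k = g \<otimes>\<^bsub>?G\<^esub> (h \<otimes>\<^bsub>?G\<^esub> k)"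
    using g h k by (simp add: fundamental_group_mult concat_loops)
qed

section \<open>Deck transformations and orbit spaces\<close>

locale universal_covering =
  fixes X :: "'a topology" and E :: "'b topology" and p :: "'b \<Rightarrow> 'a" and e :: 'b
  assumes univ: "universal_cover X E p" and lpc: "locally_path_connected_space X"
    and e: "e \<in> topspace E"
begin

abbreviation "G \<equiv> fundamental_group X (p e)"
abbreviation "deck \<equiv> deck_of E p e"

lemma conn: "connected_space E" and cov: "covering_map E X p"
  using univ by (auto simp: universal_cover_def connected_cover_def)

lemma p_cont: "continuous_map E X p" using cov by (simp add: covering_map_def)

lemma pe: "p e \<in> topspace X" using p_cont e by (auto simp: continuous_map_def)

lemma path_conn: "path_connected_space E"
  using covering_map_locally_path_connected[OF cov lpc] conn path_connected_eq_connected_space by blast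

sublocale G: group G by (rule group_fundamental_group[OF pe])

lemma deck_transformationsD:
  assumes "\<phi> \<in> deck_transformations E p"
  shows "homeomorphic_map E E \<phi>" "continuous_map E E \<phi>" "\<phi> \<in> extensional (topspace E)"
    "\<And>x. x \<in> topspace E \<Longrightarrow> \<phi> x \<in> topspace E" "\<And>x. x \<in> topspace E \<Longrightarrow> p (\<phi> x) = p x"
proof -
  show *: "homeomorphic_map E E \<phi>" "\<phi> \<in> extensional (topspace E)"
    "\<And>x. x \<in> topspace E \<Longrightarrow> p (\<phi> x) = p x" using assms by (auto simp: deck_transformations_def)
  show "continuous_map E E \<phi>" using *(1) by (rule homeomorphic_imp_continuous_map)
  then show "\<And>x. x \<in> topspace E \<Longrightarrow> \<phi> x \<in> topspace E" by (auto simp: continuous_map_def)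
qed

lemma deck_transformations_eqI:
  assumes \<phi>: "\<phi> \<in> deck_transformations E p" and \<psi>: "\<psi> \<in> deck_transformations E p"
    and a: "a \<in> topspace E" "\<phi> a = \<psi> a"
  shows "\<phi> = \<psi>"
proof (rule extensionalityI)
  show "\<phi> \<in> extensional (topspace E)" "\<psi> \<in> extensional (topspace E)"
    using \<phi> \<psi> by (auto simp: deck_transformations_def)
  show "\<phi> x = \<psi> x" if "x \<in> topspace E" for x
    using lifts_agree[OF covering_map_lift_separated[OF cov] conn, of \<phi> \<psi> a x]
      deck_transformationsD[OF \<phi>] deck_transformationsD[OF \<psi>] a that by simp
qed

text \<open>
  Lifts starting at \<open>e\<close> of homotopic loops have the same end point, and a deck transformation is
  determined by one value.
\<close>

lemma deck_of_eqI:
  assumes g: "g \<in> carrier G" and \<phi>: "\<phi> \<in> deck_transformations E p"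
    and \<gamma>: "pathin E \<gamma>" "\<gamma> 0 = e" "\<gamma> 1 = \<phi> e" "p \<circ> \<gamma> \<in> g"
  shows "deck g = \<phi>"
  unfolding deck_of_def
proof (rule the_equality)
  show "\<phi> \<in> deck_transformations E p \<and> (\<exists>\<gamma>. pathin E \<gamma> \<and> \<gamma> 0 = e \<and> \<gamma> 1 = \<phi> e \<and> p \<circ> \<gamma> \<in> g)"
    using \<phi> \<gamma> by blast
  fix \<psi> assume "\<psi> \<in> deck_transformations E p \<and> (\<exists>\<eta>. pathin E \<eta> \<and> \<eta> 0 = e \<and> \<eta> 1 = \<psi> e \<and> p \<circ> \<eta> \<in> g)"
  then obtain \<eta> where \<psi>: "\<psi> \<in> deck_transformations E p"
    and \<eta>: "pathin E \<eta>" "\<eta> 0 = e" "\<eta> 1 = \<psi> e" "p \<circ> \<eta> \<in> g" by blast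
  have "path_homotopic X (p e) (p e) (p \<circ> \<gamma>) (p \<circ> \<eta>)"
    using in_carrier_fundamental_group(2)[OF g \<gamma>(4)] \<eta>(4) by (simp add: loop_class_def)
  then have "\<gamma> 1 = \<eta> 1"
    by (rule lift_endpoints_homotopic[OF cov]) (use \<gamma> \<eta> in auto)
  then have "\<psi> e = \<phi> e" by (simp only: \<gamma>(3) \<eta>(3))
  then show "\<psi> = \<phi>" by (rule deck_transformations_eqI[OF \<psi> \<phi> e])
qed

text \<open>
  Lift a representing loop; its end point lies in the fibre of \<open>e\<close>, and regularity provides the deck
  transformation.
\<close>

lemma deck_of_path:
  assumes g: "g \<in> carrier G"
  obtains \<gamma> where "deck g \<in> deck_transformations E p"
    "pathin E \<gamma>" "\<gamma> 0 = e" "\<gamma> 1 = deck g e" "p \<circ> \<gamma> \<in> g"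
proof -
  obtain \<alpha> where l: "\<alpha> \<in> g" "\<alpha> \<in> loops_at X (p e)" "g = loop_class X (p e) \<alpha>"
    using carrier_fundamental_group_obtain[OF g] by metis
  then have l': "pathin X \<alpha>" "\<alpha> 0 = p e" "\<alpha> 1 = p e" by (auto simp: loops_at_def)
  obtain \<gamma> where \<gamma>: "pathin E \<gamma>" "\<gamma> 0 = e" "\<And>t. t \<in> {0..1} \<Longrightarrow> p (\<gamma> t) = \<alpha> t"
    using path_lifting[OF cov l'(1) e] l'(2) by metis
  have "\<gamma> 1 \<in> topspace E" using path_finish_in_topspace[OF \<gamma>(1)] .
  then obtain \<phi> where \<phi>: "\<phi> \<in> deck_transformations E p" "\<phi> e = \<gamma> 1"
    using universal_cover_regular[OF univ lpc e, of "\<gamma> 1"] \<gamma>(3)[of 1] l'(3) by auto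
  have "path_homotopic X (p e) (p e) \<alpha> (p \<circ> \<gamma>)"
    using \<gamma>(3) by (intro path_homotopic_cong l') simp
  then have pg: "p \<circ> \<gamma> \<in> g" using l(3) by (simp add: loop_class_def)
  have "deck g = \<phi>" using deck_of_eqI[OF g \<phi>(1) \<gamma>(1,2) _ pg] \<phi>(2) by simp
  then show thesis using that[of \<gamma>] \<phi> \<gamma> pg by simp
qed

lemma deck_of_in: "g \<in> carrier G \<Longrightarrow> deck g \<in> deck_transformations E p"
  using deck_of_path by metis

lemma deck_of_closed: "g \<in> carrier G \<Longrightarrow> x \<in> topspace E \<Longrightarrow> deck g x \<in> topspace E"
  using deck_transformationsD(4)[OF deck_of_in] .

lemma p_deck_of: "g \<in> carrier G \<Longrightarrow> x \<in> topspace E \<Longrightarrow> p (deck g x) = p x"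
  using deck_transformationsD(5)[OF deck_of_in] .

lemma deck_of_surj:
  assumes \<phi>: "\<phi> \<in> deck_transformations E p"
  obtains g where "g \<in> carrier G" "deck g = \<phi>"
proof -
  note d = deck_transformationsD[OF \<phi>]
  obtain \<gamma> where \<gamma>: "pathin E \<gamma>" "\<gamma> 0 = e" "\<gamma> 1 = \<phi> e"
    using path_conn e d(4)[OF e] unfolding path_connected_space_def by metis
  have l: "p \<circ> \<gamma> \<in> loops_at X (p e)"
    using pathin_compose[OF \<gamma>(1) p_cont] \<gamma> d(5)[OF e] by (simp add: loops_at_def)
  then have "deck (loop_class X (p e) (p \<circ> \<gamma>)) = \<phi>"
    using deck_of_eqI[OF loop_class_in_carrier[OF l] \<phi> \<gamma> loop_class_self[OF l]] by simp
  then show thesis using that loop_class_in_carrier[OF l] by blast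
qed

lemma deck_of_transitive:
  assumes "a \<in> topspace E" "p a = p e"
  obtains g where "g \<in> carrier G" "deck g e = a"
  using universal_cover_regular[OF univ lpc e assms(1)] assms(2) deck_of_surj by metis

text \<open>
  If \<open>\<gamma>\<close> and \<open>\<eta>\<close> are lifts belonging to \<open>g\<close> and \<open>h\<close>, then \<open>\<gamma>\<close> followed by the translate of \<open>\<eta>\<close> under
  \<open>deck g\<close> lifts the product and ends at \<open>deck g (deck h e)\<close>.
\<close>

lemma deck_of_mult:
  assumes g: "g \<in> carrier G" and h: "h \<in> carrier G" and x: "x \<in> topspace E"
  shows "deck (g \<otimes>\<^bsub>G\<^esub> h) x = deck g (deck h x)"
proof -
  obtain \<gamma> where \<gamma>: "pathin E \<gamma>" "\<gamma> 0 = e" "\<gamma> 1 = deck g e" "p \<circ> \<gamma> \<in> g"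
    using deck_of_path[OF g] by metis
  obtain \<eta> where \<eta>: "pathin E \<eta>" "\<eta> 0 = e" "\<eta> 1 = deck h e" "p \<circ> \<eta> \<in> h"
    using deck_of_path[OF h] by metis
  note dg = deck_transformationsD[OF deck_of_in[OF g]] and dh = deck_transformationsD[OF deck_of_in[OF h]]
  define \<phi> where "\<phi> = restrict (deck g \<circ> deck h) (topspace E)"
  have "homeomorphic_map E E (deck g \<circ> deck h)"
    using dh(1) dg(1) by (rule homeomorphic_map_compose)
  then have "homeomorphic_map E E \<phi>" by (rule homeomorphic_map_eq) (simp add: \<phi>_def)
  then have \<phi>: "\<phi> \<in> deck_transformations E p"
    using dg(5) dh(4,5) by (simp add: deck_transformations_def \<phi>_def)
  let ?c = "concat_paths \<gamma> (deck g \<circ> \<eta>)"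
  have c: "pathin E ?c" using pathin_concat[OF \<gamma>(1) pathin_compose[OF \<eta>(1) dg(2)]] \<gamma> \<eta> by simp
  have c01: "?c 0 = e" "?c 1 = \<phi> e" using \<gamma> \<eta> e by (simp_all add: concat_paths_def \<phi>_def)
  have l: "p \<circ> \<gamma> \<in> loops_at X (p e)" "p \<circ> \<eta> \<in> loops_at X (p e)"
    "g = loop_class X (p e) (p \<circ> \<gamma>)" "h = loop_class X (p e) (p \<circ> \<eta>)"
    using in_carrier_fundamental_group[OF g \<gamma>(4)] in_carrier_fundamental_group[OF h \<eta>(4)] by auto
  have gh: "g \<otimes>\<^bsub>G\<^esub> h = loop_class X (p e) (concat_paths (p \<circ> \<gamma>) (p \<circ> \<eta>))"
    using fundamental_group_mult[OF l(1,2)] l(3,4) by simp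
  have "\<eta> t \<in> topspace E" if "t \<in> {0..1}" for t using path_image_subset_topspace[OF \<eta>(1)] that by auto
  then have "concat_paths (p \<circ> \<gamma>) (p \<circ> \<eta>) t = (p \<circ> ?c) t" if "t \<in> {0..1}" for t
    using that dg(5) by (simp add: concat_paths_def)
  then have "path_homotopic X (p e) (p e) (concat_paths (p \<circ> \<gamma>) (p \<circ> \<eta>)) (p \<circ> ?c)"
    using concat_loops[OF l(1,2)] by (intro path_homotopic_cong) (auto simp: loops_at_def)
  then have "p \<circ> ?c \<in> g \<otimes>\<^bsub>G\<^esub> h" unfolding gh by (simp add: loop_class_def)
  from deck_of_eqI[OF G.m_closed[OF g h] \<phi> c c01 this] have "deck (g \<otimes>\<^bsub>G\<^esub> h) = \<phi>" .
  then show ?thesis using x by (simp add: \<phi>_def)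
qed

lemma deck_of_one:
  assumes x: "x \<in> topspace E"
  shows "deck \<one>\<^bsub>G\<^esub> x = x"
proof -
  have "homeomorphic_map E E (restrict id (topspace E))"
    by (rule homeomorphic_map_eq[of _ _ id]) auto
  then have \<phi>: "restrict id (topspace E) \<in> deck_transformations E p"
    by (simp add: deck_transformations_def)
  have "(\<lambda>t. p e) \<in> loops_at X (p e)" using pe by (simp add: loops_at_def)
  then have "p \<circ> (\<lambda>t. e) \<in> \<one>\<^bsub>G\<^esub>"
    using loop_class_self by (simp add: fundamental_group_one o_def)
  then have "deck \<one>\<^bsub>G\<^esub> = restrict id (topspace E)"
    using e by (intro deck_of_eqI[OF G.one_closed \<phi>, of "\<lambda>t. e"]) simp_all
  then show ?thesis using x by simp
qed

lemma deck_of_inv: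
  assumes "g \<in> carrier G" "x \<in> topspace E"
  shows "deck (inv\<^bsub>G\<^esub> g) (deck g x) = x" "deck g (deck (inv\<^bsub>G\<^esub> g) x) = x"
  using deck_of_mult[of "inv\<^bsub>G\<^esub> g" g x] deck_of_mult[of g "inv\<^bsub>G\<^esub> g" x] deck_of_one[of x] assms by simp_all

definition orbit :: "(real \<Rightarrow> 'a) set set \<Rightarrow> 'b \<Rightarrow> 'b set" where
  "orbit H x = (\<lambda>g. deck g x) ` H"

lemma orbit_self: "subgroup H G \<Longrightarrow> x \<in> topspace E \<Longrightarrow> x \<in> orbit H x"
  using subgroup.one_closed deck_of_one unfolding orbit_def by (metis image_eqI)

lemma orbit_eq:
  assumes H: "subgroup H G" and x: "x \<in> topspace E" and h: "h \<in> H"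
  shows "orbit H (deck h x) = orbit H x"
proof -
  interpret H: subgroup H G by fact
  have sub: "orbit H (deck k y) \<subseteq> orbit H y" if k: "k \<in> H" and y: "y \<in> topspace E" for k y
  proof
    fix z assume "z \<in> orbit H (deck k y)"
    then obtain g where g: "g \<in> H" "z = deck g (deck k y)" by (auto simp: orbit_def)
    then have "z = deck (g \<otimes>\<^bsub>G\<^esub> k) y" using k y by (simp add: deck_of_mult)
    then show "z \<in> orbit H y" using g k unfolding orbit_def by blast
  qed
  have hc: "h \<in> carrier G" using h by simp
  have "orbit H x = orbit H (deck (inv\<^bsub>G\<^esub> h) (deck h x))" using deck_of_inv(1)[OF hc x] by simp
  also have "\<dots> \<subseteq> orbit H (deck h x)" using sub deck_of_closed[OF hc x] h by simp
  finally show ?thesis using sub[OF h x] by simp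
qed

lemma orbit_eqD:
  assumes H: "subgroup H G" and x: "x \<in> topspace E" and y: "y \<in> topspace E" "orbit H x = orbit H y"
  obtains h where "h \<in> H" "y = deck h x"
  using orbit_self[OF H y(1)] y(2) unfolding orbit_def by (metis imageE)

lemma orbit_proj_orbit:
  assumes H: "subgroup H G" and x: "x \<in> topspace E"
  shows "orbit_proj p (orbit H x) = p x"
proof -
  have "H \<subseteq> carrier G" using H by (rule subgroup.subset)
  then have "p ` orbit H x = {p x}"
    using orbit_self[OF H x] p_deck_of[OF _ x] unfolding orbit_def by auto
  then show ?thesis by (simp add: orbit_proj_def)
qed

lemma openin_orbit_image:
  assumes H: "subgroup H G" and V: "openin E V"
  shows "openin (quotient_topology E (orbit H)) (orbit H ` V)"
proof -
  have VE: "V \<subseteq> topspace E" using V openin_subset by blast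
  have HG: "H \<subseteq> carrier G" using H by (rule subgroup.subset)
  have "{x \<in> topspace E. orbit H x \<in> orbit H ` V} = (\<Union>h\<in>H. deck h ` V)"
  proof (intro equalityI subsetI)
    fix x assume "x \<in> {x \<in> topspace E. orbit H x \<in> orbit H ` V}"
    then obtain v where v: "x \<in> topspace E" "v \<in> V" "orbit H v = orbit H x" by auto
    then obtain h where "h \<in> H" "x = deck h v" using orbit_eqD[OF H _ v(1,3)] VE by blast
    then show "x \<in> (\<Union>h\<in>H. deck h ` V)" using v by blast
  next
    fix x assume "x \<in> (\<Union>h\<in>H. deck h ` V)"
    then obtain h v where h: "h \<in> H" "v \<in> V" "x = deck h v" by blast
    then have "v \<in> topspace E" "h \<in> carrier G" using VE HG by auto
    then show "x \<in> {x \<in> topspace E. orbit H x \<in> orbit H ` V}"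
      using h orbit_eq[OF H _ h(1)] deck_of_closed by simp
  qed
  moreover have "openin E (deck h ` V)" if "h \<in> H" for h
    using homeomorphic_imp_open_map[OF deck_transformationsD(1)[OF deck_of_in]] HG that V
    unfolding open_map_def by blast
  ultimately show ?thesis using VE by (auto simp: openin_quotient_topology)
qed

text \<open>
  Images of sheets are open and meet each fibre at most once. If the images of two sheets over the same
  set met, some translate of the first sheet would be the second, and their points over any given
  point would lie in the same orbit.
\<close>

lemma orbit_space_lift_separated:
  assumes H: "subgroup H G"
  shows "lift_separated (quotient_topology E (orbit H)) (orbit_proj p)"
  unfolding lift_separated_def topspace_quotient_topology
proof (intro conjI ballI impI)
  let ?Q = "quotient_topology E (orbit H)"
  have HG: "H \<subseteq> carrier G" using H by (rule subgroup.subset)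
  have el: "\<exists>U. elementary E X p U \<and> p x \<in> U" if "x \<in> topspace E" for x
  proof -
    have "p x \<in> topspace X" using that p_cont by (auto simp: continuous_map_def)
    then show ?thesis using elementary_base[OF cov lpc openin_topspace] by metis
  qed
  show "\<exists>V. openin ?Q V \<and> c \<in> V \<and> inj_on (orbit_proj p) V" if c: "c \<in> orbit H ` topspace E" for c
  proof -
    obtain x where x: "x \<in> topspace E" "c = orbit H x" using c by auto
    obtain U where U: "elementary E X p U" "p x \<in> U" using el[OF x(1)] by auto
    note s = sheet_elementary[OF U(1) x(1) U(2)]
    have "inj_on (orbit_proj p) (orbit H ` sheet E p U x)"
    proof (rule inj_onI)
      fix c d assume "c \<in> orbit H ` sheet E p U x" "d \<in> orbit H ` sheet E p U x"
        and eq: "orbit_proj p c = orbit_proj p d"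
      then obtain v w where vw: "v \<in> sheet E p U x" "w \<in> sheet E p U x" "c = orbit H v" "d = orbit H w" by blast
      moreover have "v \<in> topspace E" "w \<in> topspace E" using vw s(3) by auto
      ultimately have "p v = p w" using eq orbit_proj_orbit[OF H] by simp
      then show "c = d" using inj_onD[OF s(5)] vw by blast
    qed
    then show ?thesis using openin_orbit_image[OF H s(2)] s(1) x(2) by blast
  qed
  fix c d assume "c \<in> orbit H ` topspace E" "d \<in> orbit H ` topspace E"
    and cd: "orbit_proj p c = orbit_proj p d \<and> c \<noteq> d"
  then obtain x y where x: "x \<in> topspace E" "c = orbit H x" and y: "y \<in> topspace E" "d = orbit H y" by auto
  have pxy: "p x = p y" using cd x y orbit_proj_orbit[OF H] by simp
  obtain U where U: "elementary E X p U" "p x \<in> U" using el[OF x(1)] by auto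
  note s = sheet_elementary[OF U(1) x(1) U(2)]
  have pyU: "p y \<in> U" using U(2) pxy by simp
  note t = sheet_elementary[OF U(1) y(1) pyU]
  have "disjnt (orbit H ` sheet E p U x) (orbit H ` sheet E p U y)"
  proof (rule ccontr)
    assume "\<not> disjnt (orbit H ` sheet E p U x) (orbit H ` sheet E p U y)"
    then obtain v w where vw: "v \<in> sheet E p U x" "w \<in> sheet E p U y" "orbit H v = orbit H w"
      unfolding disjnt_iff by blast
    have vE: "v \<in> topspace E" "w \<in> topspace E" using vw s(3) t(3) by auto
    obtain h where h: "h \<in> H" "w = deck h v" using orbit_eqD[OF H vE vw(3)] .
    have hG: "h \<in> carrier G" using h HG by auto
    have "connectedin E (deck h ` sheet E p U x)"
      using connectedin_continuous_map_image[OF deck_transformationsD(2)[OF deck_of_in[OF hG]] s(8)] .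
    moreover have "p ` deck h ` sheet E p U x \<subseteq> U" using p_deck_of[OF hG] s(3,4) by fastforce
    moreover have "w \<in> deck h ` sheet E p U x" using h vw by auto
    ultimately have "deck h ` sheet E p U x \<subseteq> sheet E p U w" by (rule connectedin_subset_component_sheet[OF U(1)])
    then have "deck h x \<in> sheet E p U y" using s(1) t(7)[OF vw(2)] by auto
    then have "deck h x = y" using inj_onD[OF t(5) _ _ t(1)] p_deck_of[OF hG x(1)] pxy by simp
    then show False using orbit_eq[OF H x(1) h(1)] cd x y by simp
  qed
  then show "\<exists>V W. openin ?Q V \<and> openin ?Q W \<and> c \<in> V \<and> d \<in> W \<and> disjnt V W"
    using openin_orbit_image[OF H s(2)] openin_orbit_image[OF H t(2)] s(1) t(1) x(2) y(2) by blast
qed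

text \<open>
  The two lifts \<open>x \<mapsto> F [x]\<^sub>H\<close> and \<open>x \<mapsto> [deck k0 x]\<^sub>K\<close> are compared along the \<open>K\<close> orbit of \<open>e\<close>. Orbits
  only see the images of \<open>H\<close> and \<open>K\<close> among the deck transformations, hence the assumption that \<open>H\<close>
  contains every element acting trivially.
\<close>

lemma isomorphic_orbit_spaces_imp_subset:
  assumes H: "subgroup H G" and K: "K \<lhd> G"
    and ker: "\<And>g. g \<in> carrier G \<Longrightarrow> deck g e = e \<Longrightarrow> g \<in> H"
    and iso: "isomorphic_covers (quotient_topology E (orbit H)) (orbit_proj p)
                (quotient_topology E (orbit K)) (orbit_proj p)"
  shows "K \<subseteq> H"
proof
  interpret K: normal K G by fact
  have Ks: "subgroup K G" by unfold_locales
  let ?QH = "quotient_topology E (orbit H)" and ?QK = "quotient_topology E (orbit K)"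
  obtain F where F: "homeomorphic_map ?QH ?QK F"
    and Fp: "\<And>c. c \<in> orbit H ` topspace E \<Longrightarrow> orbit_proj p (F c) = orbit_proj p c"
    using iso unfolding isomorphic_covers_def topspace_quotient_topology by blast
  have Fim: "F ` orbit H ` topspace E = orbit K ` topspace E" and Finj: "inj_on F (orbit H ` topspace E)"
    using homeomorphic_imp_surjective_map[OF F] homeomorphic_imp_injective_map[OF F]
    by (auto simp: topspace_quotient_topology)
  have "F (orbit H e) \<in> orbit K ` topspace E" using Fim e by blast
  then obtain a where a: "a \<in> topspace E" "F (orbit H e) = orbit K a" by blast
  have "p a = p e" using Fp[of "orbit H e"] a e orbit_proj_orbit[OF H e] orbit_proj_orbit[OF Ks a(1)] by simp
  then obtain k0 where k0: "k0 \<in> carrier G" "deck k0 e = a" using deck_of_transitive[OF a(1)] by metis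
  \<comment> \<open>Both sides are lifts of \<open>p\<close> to the second orbit space.\<close>
  have agree: "F (orbit H y) = orbit K (deck k0 y)" if y: "y \<in> topspace E" for y
  proof -
    have "continuous_map E ?QK (F \<circ> orbit H)"
      using continuous_map_compose[OF quotient_imp_continuous_map[OF quotient_map_quotient_topology]
          homeomorphic_imp_continuous_map[OF F]] .
    moreover have "continuous_map E ?QK (orbit K \<circ> deck k0)"
      using continuous_map_compose[OF deck_transformationsD(2)[OF deck_of_in[OF k0(1)]]
          quotient_imp_continuous_map[OF quotient_map_quotient_topology]] .
    moreover have "orbit_proj p ((F \<circ> orbit H) z) = orbit_proj p ((orbit K \<circ> deck k0) z)"
      if z: "z \<in> topspace E" for z
      using z Fp orbit_proj_orbit[OF H z] orbit_proj_orbit[OF Ks deck_of_closed[OF k0(1) z]]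
        p_deck_of[OF k0(1) z] by simp
    ultimately show ?thesis
      using lifts_agree[OF orbit_space_lift_separated[OF Ks] conn, of "F \<circ> orbit H" "orbit K \<circ> deck k0" e y]
        a k0 e y by simp
  qed
  fix k assume k: "k \<in> K"
  have kG: "k \<in> carrier G" using k by simp
  have ke: "deck k e \<in> topspace E" using deck_of_closed[OF kG e] .
  \<comment> \<open>Normality of \<open>K\<close>: translating by \<open>k0\<close> after \<open>k\<close> is translating by an element of \<open>K\<close> after \<open>k0\<close>.\<close>
  let ?k' = "k0 \<otimes>\<^bsub>G\<^esub> k \<otimes>\<^bsub>G\<^esub> inv\<^bsub>G\<^esub> k0"
  have k': "?k' \<in> K" using K.inv_op_closed2[OF k0(1) k] .
  have "deck ?k' (deck k0 e) = deck k0 (deck k e)"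
    using k0 kG e a(1) deck_of_inv(1)[OF k0(1) e] by (simp add: deck_of_mult)
  then have "orbit K (deck k0 (deck k e)) = orbit K (deck k0 e)"
    using orbit_eq[OF Ks deck_of_closed[OF k0(1) e] k'] by simp
  then have "F (orbit H (deck k e)) = F (orbit H e)" using agree e ke by simp
  then have "orbit H e = orbit H (deck k e)" using inj_onD[OF Finj] e ke by blast
  then obtain h where h: "h \<in> H" "deck k e = deck h e" using orbit_eqD[OF H e ke] by metis
  have hG: "h \<in> carrier G" using subgroup.mem_carrier[OF H h(1)] .
  have "deck (inv\<^bsub>G\<^esub> h \<otimes>\<^bsub>G\<^esub> k) e = e" using h(2) hG kG e by (simp add: deck_of_mult deck_of_inv)
  then have "inv\<^bsub>G\<^esub> h \<otimes>\<^bsub>G\<^esub> k \<in> H" using ker hG kG by simp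
  then have "h \<otimes>\<^bsub>G\<^esub> (inv\<^bsub>G\<^esub> h \<otimes>\<^bsub>G\<^esub> k) \<in> H" using subgroup.m_closed[OF H h(1)] by blast
  moreover have "h \<otimes>\<^bsub>G\<^esub> (inv\<^bsub>G\<^esub> h \<otimes>\<^bsub>G\<^esub> k) = k" using hG kG by (simp add: G.m_assoc[symmetric])
  ultimately show "k \<in> H" by simp
qed

end

section \<open>Length spaces and the covering spectrum\<close>

lemma path_length_cong:
  assumes "\<And>t. t \<in> {0..1} \<Longrightarrow> \<gamma> t = \<eta> t"
  shows "path_length M \<gamma> = path_length M \<eta>"
  unfolding path_length_def
proof (rule SUP_cong[OF refl])
  fix ts :: "real list" assume "ts \<in> {ts. sorted ts \<and> set ts \<subseteq> {0..1}}"
  then have "\<gamma> (ts ! i) = \<eta> (ts ! i)" if "i < length ts" for i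
    using assms nth_mem[OF that] by auto
  then show "(\<Sum>i<length ts - 1. ennreal (mdist M (\<gamma> (ts ! i)) (\<gamma> (ts ! Suc i)))) =
      (\<Sum>i<length ts - 1. ennreal (mdist M (\<eta> (ts ! i)) (\<eta> (ts ! Suc i))))"
    by (intro sum.cong) auto
qed

lemma path_length_const: "a \<in> mspace M \<Longrightarrow> path_length M (\<lambda>t. a) = 0"
proof -
  assume "a \<in> mspace M"
  then have "mdist M a a = 0" using Metric_space.mdist_zero[OF Metric_space_mspace_mdist] by metis
  then have "path_length M (\<lambda>t. a) \<le> 0" unfolding path_length_def by (intro SUP_least) simp
  then show ?thesis by simp
qed

lemma mdist_le_path_length:
  assumes "t \<in> {0..1}"
  shows "ennreal (mdist M (\<gamma> 0) (\<gamma> t)) \<le> path_length M \<gamma>"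
proof -
  have "(\<Sum>i<length [0, t] - 1. ennreal (mdist M (\<gamma> ([0, t] ! i)) (\<gamma> ([0, t] ! Suc i)))) \<le> path_length M \<gamma>"
    unfolding path_length_def by (rule SUP_upper) (use assms in auto)
  then show ?thesis by simp
qed

text \<open>
  A minimizing curve starting at the centre of a ball stays in the ball as long as its end point is in it:
  each of its points is at most as far from the centre as its length, which is the distance of the
  end points.
\<close>

lemma complete_length_space_locally_path_connected:
  assumes M: "complete_length_space M"
  shows "locally_path_connected_space (mtopology_of M)"
  unfolding locally_path_connected_space
proof (intro allI impI)
  interpret Metric_space "mspace M" "mdist M" by (rule Metric_space_mspace_mdist)
  let ?X = "mtopology_of M"
  have X: "?X = mtopology" by (simp add: mtopology_of_def)
  fix V x assume "openin ?X V \<and> x \<in> V"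
  then obtain r where r: "r > 0" "mball x r \<subseteq> V" and x: "x \<in> mspace M"
    unfolding X openin_mtopology by blast
  let ?U = "mball x r"
  have reach: "path_component_of (subtopology ?X ?U) x y" if y: "y \<in> ?U" for y
  proof -
    have yM: "y \<in> mspace M" "mdist M x y < r" using y by auto
    obtain \<gamma> where \<gamma>: "pathin ?X \<gamma>" "\<gamma> 0 = x" "\<gamma> 1 = y" "path_length M \<gamma> = ennreal (mdist M x y)"
      using M x yM(1) unfolding complete_length_space_def by blast
    have "\<gamma> t \<in> ?U" if t: "t \<in> {0..1}" for t
    proof -
      have "mdist M x (\<gamma> t) \<le> mdist M x y"
        using mdist_le_path_length[OF t, of M \<gamma>] \<gamma> by (simp add: ennreal_le_iff)
      moreover have "\<gamma> t \<in> mspace M" using path_image_subset_topspace[OF \<gamma>(1)] t by auto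
      ultimately show ?thesis using x yM by simp
    qed
    then show ?thesis using \<gamma> unfolding path_component_of_def pathin_subtopology by blast
  qed
  have "path_connected_space (subtopology ?X ?U)"
    unfolding path_connected_space_iff_path_component
    using reach path_component_of_sym path_component_of_trans by (metis IntD2 topspace_subtopology)
  moreover have "?U \<subseteq> topspace ?X" by auto
  ultimately have "path_connectedin ?X ?U" by (simp add: path_connectedin_def)
  moreover have "openin ?X ?U" unfolding X by (rule openin_mball)
  ultimately show "\<exists>U. openin ?X U \<and> path_connectedin ?X U \<and> x \<in> U \<and> U \<subseteq> V"
    using r x by (metis centre_in_mball_iff)
qed

locale universal_cover_of_metric = universal_covering "mtopology_of M" E p e
  for M :: "'a metric" and E :: "'b topology" and p e
begin

abbreviation "len \<equiv> shift_length M E p e"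

lemma deck_of_lifted_dist_le:
  assumes g: "g \<in> carrier G"
  shows "lifted_dist M E p (deck g x) (deck g y) \<le> lifted_dist M E p x y"
  unfolding lifted_dist_def
proof (rule INF_mono)
  fix \<gamma> assume "\<gamma> \<in> {\<gamma>. pathin E \<gamma> \<and> \<gamma> 0 = x \<and> \<gamma> 1 = y}"
  then have \<gamma>: "pathin E \<gamma>" "\<gamma> 0 = x" "\<gamma> 1 = y" by auto
  note d = deck_transformationsD[OF deck_of_in[OF g]]
  have "pathin E (deck g \<circ> \<gamma>)" using pathin_compose[OF \<gamma>(1) d(2)] .
  moreover have "\<gamma> t \<in> topspace E" if "t \<in> {0..1}" for t
    using path_image_subset_topspace[OF \<gamma>(1)] that by auto
  then have "path_length M (p \<circ> (deck g \<circ> \<gamma>)) = path_length M (p \<circ> \<gamma>)"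
    using d(5) by (intro path_length_cong) simp
  ultimately show "\<exists>\<eta>\<in>{\<eta>. pathin E \<eta> \<and> \<eta> 0 = deck g x \<and> \<eta> 1 = deck g y}.
      path_length M (p \<circ> \<eta>) \<le> path_length M (p \<circ> \<gamma>)"
    using \<gamma> by (intro bexI[of _ "deck g \<circ> \<gamma>"]) auto
qed

text \<open>
  Displacement of \<open>deck k x\<close> under the conjugate equals displacement of \<open>x\<close> under \<open>g\<close>, up to the isometry
  \<open>deck k\<close>. The inequality is enough for the set of short elements to be closed under conjugation.
\<close>

lemma shift_length_conj_le:
  assumes g: "g \<in> carrier G" and k: "k \<in> carrier G"
  shows "len (k \<otimes>\<^bsub>G\<^esub> g \<otimes>\<^bsub>G\<^esub> inv\<^bsub>G\<^esub> k) \<le> len g"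
  unfolding shift_length_def
proof (rule INF_mono)
  fix x assume x: "x \<in> topspace E"
  note kx = deck_of_closed[OF k x]
  have "deck (k \<otimes>\<^bsub>G\<^esub> g \<otimes>\<^bsub>G\<^esub> inv\<^bsub>G\<^esub> k) (deck k x) = deck k (deck g x)"
    using g k x kx by (simp add: deck_of_mult deck_of_inv)
  then have "lifted_dist M E p (deck (k \<otimes>\<^bsub>G\<^esub> g \<otimes>\<^bsub>G\<^esub> inv\<^bsub>G\<^esub> k) (deck k x)) (deck k x)
      \<le> lifted_dist M E p (deck g x) x" using deck_of_lifted_dist_le[OF k] by simp
  then show "\<exists>y\<in>topspace E. lifted_dist M E p (deck (k \<otimes>\<^bsub>G\<^esub> g \<otimes>\<^bsub>G\<^esub> inv\<^bsub>G\<^esub> k) y) y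
      \<le> lifted_dist M E p (deck g x) x" using kx by blast
qed

lemma shift_length_trivial:
  assumes "deck g e = e"
  shows "len g = 0"
proof -
  have "len g \<le> lifted_dist M E p (deck g e) e"
    unfolding shift_length_def using e by (rule INF_lower)
  also have "\<dots> \<le> path_length M (p \<circ> (\<lambda>t. e))"
    unfolding lifted_dist_def assms by (rule INF_lower) (use e in simp)
  also have "\<dots> = 0" using path_length_const[of "p e" M] pe by (simp add: o_def)
  finally show ?thesis by simp
qed

lemma short_subset: "{g \<in> carrier G. len g < c} \<subseteq> carrier G"
  by blast

lemma delta_subgroup_normal: "delta_subgroup M E p e \<delta> \<lhd> G"
  unfolding delta_subgroup_def
proof (rule G.normal_generateI[OF short_subset])
  fix g k assume "g \<in> {g \<in> carrier G. len g < ennreal (2 * \<delta>)}" and k: "k \<in> carrier G"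
  then have g: "g \<in> carrier G" "len g < ennreal (2 * \<delta>)" by auto
  then show "k \<otimes>\<^bsub>G\<^esub> g \<otimes>\<^bsub>G\<^esub> inv\<^bsub>G\<^esub> k \<in> {g \<in> carrier G. len g < ennreal (2 * \<delta>)}"
    using le_less_trans[OF shift_length_conj_le[OF g(1) k] g(2)] k by simp
qed

lemma delta_subgroup_subgroup: "subgroup (delta_subgroup M E p e \<delta>) G"
  unfolding delta_subgroup_def by (rule G.generate_is_subgroup[OF short_subset])

lemma delta_subgroup_mono:
  assumes "\<delta> \<le> \<delta>'"
  shows "delta_subgroup M E p e \<delta> \<subseteq> delta_subgroup M E p e \<delta>'"
  unfolding delta_subgroup_def
proof (rule G.mono_generate)
  have "ennreal (2 * \<delta>) \<le> ennreal (2 * \<delta>')" using assms by (intro ennreal_leI) simp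
  then show "{g \<in> carrier G. len g < ennreal (2 * \<delta>)} \<subseteq> {g \<in> carrier G. len g < ennreal (2 * \<delta>')}"
    by (auto intro: less_le_trans)
qed

lemma kernel_subset_delta_subgroup:
  assumes "0 < \<delta>" "g \<in> carrier G" "deck g e = e"
  shows "g \<in> delta_subgroup M E p e \<delta>"
  unfolding delta_subgroup_def
  by (rule generate.incl) (use assms shift_length_trivial in simp)

lemma isomorphic_delta_covers_iff:
  assumes "0 < \<delta>" "\<delta> < \<delta>'"
  shows "isomorphic_covers (delta_cover M E p e \<delta>) (orbit_proj p) (delta_cover M E p e \<delta>') (orbit_proj p)
     \<longleftrightarrow> delta_subgroup M E p e \<delta> = delta_subgroup M E p e \<delta>'"
proof
  have c: "delta_cover M E p e d = quotient_topology E (orbit (delta_subgroup M E p e d))" for d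
    unfolding delta_cover_def by (simp add: delta_orbit_def[abs_def] orbit_def[abs_def])
  assume "isomorphic_covers (delta_cover M E p e \<delta>) (orbit_proj p) (delta_cover M E p e \<delta>') (orbit_proj p)"
  then have "delta_subgroup M E p e \<delta>' \<subseteq> delta_subgroup M E p e \<delta>"
    unfolding c using kernel_subset_delta_subgroup[OF assms(1)]
    by (intro isomorphic_orbit_spaces_imp_subset[OF delta_subgroup_subgroup delta_subgroup_normal])
  then show "delta_subgroup M E p e \<delta> = delta_subgroup M E p e \<delta>'"
    using delta_subgroup_mono[of \<delta> \<delta>'] assms(2) by simp
next
  assume "delta_subgroup M E p e \<delta> = delta_subgroup M E p e \<delta>'"
  then have "delta_cover M E p e \<delta> = delta_cover M E p e \<delta>'"
    by (simp add: delta_cover_def delta_orbit_def[abs_def])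
  then show "isomorphic_covers (delta_cover M E p e \<delta>) (orbit_proj p) (delta_cover M E p e \<delta>') (orbit_proj p)"
    unfolding isomorphic_covers_def by (intro exI[of _ id]) simp
qed

lemma CovSpec_eq:
  "CovSpec M E p e = {\<delta>. \<delta> > 0 \<and> (\<forall>\<delta>' > \<delta>. delta_subgroup M E p e \<delta> \<noteq> delta_subgroup M E p e \<delta>')}"
  unfolding CovSpec_def using isomorphic_delta_covers_iff by blast

end

theorem theorem3p2:
  fixes X :: "'a metric" and X' :: "'b topology" and p :: "'b \<Rightarrow> 'a" and e :: 'b
    and Y :: "'c metric" and Y' :: "'d topology" and q :: "'d \<Rightarrow> 'c" and f :: 'd
  assumes "complete_length_space X" and "complete_length_space Y"
    and "universal_cover (mtopology_of X) X' p"
    and "universal_cover (mtopology_of Y) Y' q"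
    and "e \<in> topspace X'" and "f \<in> topspace Y'"
    and "same_marked_shift_spectrum X X' p e Y Y' q f"
  shows "CovSpec X X' p e = CovSpec Y Y' q f"
proof -
  interpret X: universal_cover_of_metric X X' p e
    using assms by unfold_locales (auto intro: complete_length_space_locally_path_connected)
  interpret Y: universal_cover_of_metric Y Y' q f
    using assms by unfold_locales (auto intro: complete_length_space_locally_path_connected)
  obtain \<Phi> where iso: "\<Phi> \<in> iso X.G Y.G" and len: "\<And>g. g \<in> carrier X.G \<Longrightarrow> Y.len (\<Phi> g) = X.len g"
    using assms(7) unfolding same_marked_shift_spectrum_def by blast
  have bij: "bij_betw \<Phi> (carrier X.G) (carrier Y.G)" and hom: "\<Phi> \<in> hom X.G Y.G"
    using iso by (auto simp: iso_def)
  interpret \<Phi>: group_hom X.G Y.G \<Phi> using hom by unfold_locales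
  have "\<Phi> ` {g \<in> carrier X.G. X.len g < c} = {g \<in> carrier Y.G. Y.len g < c}" for c
  proof (intro equalityI subsetI)
    fix g' assume g': "g' \<in> {g \<in> carrier Y.G. Y.len g < c}"
    then obtain g where "g \<in> carrier X.G" "g' = \<Phi> g" using bij by (auto simp: bij_betw_def)
    then show "g' \<in> \<Phi> ` {g \<in> carrier X.G. X.len g < c}" using g' len by simp
  qed (use len in auto)
  then have img: "delta_subgroup Y Y' q f \<delta> = \<Phi> ` delta_subgroup X X' p e \<delta>" for \<delta>
    using \<Phi>.generate_img[OF X.short_subset] by (simp add: delta_subgroup_def)
  have sub: "delta_subgroup X X' p e \<delta> \<subseteq> carrier X.G" for \<delta>
    using subgroup.subset[OF X.delta_subgroup_subgroup] .
  have "delta_subgroup Y Y' q f \<delta> = delta_subgroup Y Y' q f \<delta>' \<longleftrightarrow>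
      delta_subgroup X X' p e \<delta> = delta_subgroup X X' p e \<delta>'" for \<delta> \<delta>'
    unfolding img using inj_on_image_eq_iff[OF bij_betw_imp_inj_on[OF bij] sub sub] .
  then show ?thesis unfolding X.CovSpec_eq Y.CovSpec_eq by simp
qed

end
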